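(* The minimax regret $R_n^*$ of any finite linear partial monitoring game satisfies $$R_n^*=\begin{cases}0&\text{if there is only one Pareto optimal action,}\\ \tilde\Theta(n^{1/2})&\text{for locally observable games,}\\ \tilde\Theta(n^{2/3})&\text{for globally observable games,}\\ \Omega(n)&\text{otherwise,}\end{cases}$$ where the cases are read in order (each case applies when none of the previous ones does), asymptotics are in $n$ for a fixed game, and hidden constants may depend on the game.
   Context: A finite linear partial monitoring game consists of a finite action set $\mathcal X\subset\mathbb R^d$ and known matrices $A_x\in\mathbb R^{d\times m}$, $x\in\mathcal X$, with $\|A_x\|_2\le1$ and $\operatorname{diam}(\mathcal X)\le1$. For an unknown parameter $\theta\in\mathbb R^d$ with $\|\theta\|_2\le1$, in each round $t=1,\dots,n$ the learner chooses $x_t\in\mathcal X$ (possibly randomized, based on past actions and observations) and observes $a_t=A_{x_t}^\top\theta+\epsilon_t$ with independent standard Gaussian noise $\epsilon_t\sim\mathcal N(0,I_m)$; the reward $\langle x_t,\theta\rangle$ is not observed. For a policy $\pi$, $R_n(\pi,\theta)=\sum_{t=1}^n\langle x^*-x_t,\theta\rangle$ with $x^*\in\arg\max_{x\in\mathcal X}\langle x,\theta\rangle$, and $R_n^*=\inf_\pi\sup_{\theta:\|\theta\|_2\le1}\mathbb E[R_n(\pi,\theta)]$. An action is Pareto optimal if it is an extreme point of the convex hull $\operatorname{conv}(\mathcal X)$. Let $\mathcal P(\theta)=\{x\in\mathcal X:\langle x,\theta\rangle=\max_{y\in\mathcal X}\langle y,\theta\rangle\}$ and $\mathcal P(\mathcal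 C)=\bigcup_{\theta\in\mathcal C}\mathcal P(\theta)$ for $\mathcal C\subseteq\mathbb R^d$; $\operatorname{span}(A_z:z\in\mathcal Y)$ is the span of all columns of the matrices $A_z$, $z\in\mathcal Y$. The game is globally observable if $x-y\in\operatorname{span}(A_z:z\in\mathcal X)$ for all $x,y\in\mathcal X$. It is locally observable if for every convex $\mathcal C\subset\mathbb R^d$, $x-y\in\operatorname{span}(A_z:z\in\mathcal P(\mathcal C))$ for all $x,y\in\mathcal P(\mathcal C)$. $\tilde\Theta$ is $\Theta$ up to factors polylogarithmic in $n$. *)

theory Defs
  imports "HOL-Probability.Probability" "HOL-Library.Landau_Symbols"
begin

section \<open>Combinatorial structure of a linear partial monitoring game\<close>

text \<open>
  A game is a finite nonempty set \<open>X\<close> of actions in \<open>real^'d\<close> together with a feedback matrix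
  \<open>A x :: real^'m^'d\<close> (that is, \<open>d\<close> rows and \<open>m\<close> columns) for every \<open>x \<in> X\<close>; the values of \<open>A\<close>
  outside \<open>X\<close> are never used.
\<close>

definition pareto_optimal :: "(real^'d) set \<Rightarrow> real^'d \<Rightarrow> bool" where
  "pareto_optimal X x \<longleftrightarrow> x \<in> X \<and> x extreme_point_of (convex hull X)"

definition optimal_actions :: "(real^'d) set \<Rightarrow> real^'d \<Rightarrow> (real^'d) set" where
  "optimal_actions X \<theta> = {x \<in> X. x \<bullet> \<theta> = Max ((\<lambda>y. y \<bullet> \<theta>) ` X)}"

definition optimal_actions_on :: "(real^'d) set \<Rightarrow> (real^'d) set \<Rightarrow> (real^'d) set" where
  "optimal_actions_on X \<C> = (\<Union>\<theta>\<in>\<C>. optimal_actions X \<theta>)"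

definition feedback_span :: "(real^'d \<Rightarrow> real^'m^'d) \<Rightarrow> (real^'d) set \<Rightarrow> (real^'d) set" where
  "feedback_span A Y = span (\<Union>z\<in>Y. columns (A z))"

definition globally_observable :: "(real^'d) set \<Rightarrow> (real^'d \<Rightarrow> real^'m^'d) \<Rightarrow> bool" where
  "globally_observable X A \<longleftrightarrow> (\<forall>x\<in>X. \<forall>y\<in>X. x - y \<in> feedback_span A X)"

definition locally_observable :: "(real^'d) set \<Rightarrow> (real^'d \<Rightarrow> real^'m^'d) \<Rightarrow> bool" where
  "locally_observable X A \<longleftrightarrow>
     (\<forall>\<C>. convex \<C> \<longrightarrow>
        (\<forall>x\<in>optimal_actions_on X \<C>. \<forall>y\<in>optimal_actions_on X \<C>.
           x - y \<in> feedback_span A (optimal_actions_on X \<C>)))"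


section \<open>Interaction protocol and regret\<close>

text \<open>
  Rounds are numbered from 0. A round produces a pair (action, observation), and a history of
  \<open>t\<close> rounds is a point of the product space over the index set \<open>{0..<t}\<close>.
\<close>

abbreviation round_space :: "(real^'d) set \<Rightarrow> ((real^'d) \<times> (real^'m)) measure" where
  "round_space X \<equiv> count_space X \<Otimes>\<^sub>M borel"

text \<open>A (randomized) policy is a probability kernel from histories to actions for every round.\<close>

definition policies ::
  "(real^'d) set \<Rightarrow> (nat \<Rightarrow> (nat \<Rightarrow> (real^'d) \<times> (real^'m)) \<Rightarrow> (real^'d) measure) set" where
  "policies X =
     {\<pi>. \<forall>t. \<pi> t \<in> PiM {0..<t} (\<lambda>_. round_space X) \<rightarrow>\<^sub>M prob_algebra (count_space X)}"

definition gaussian_noise :: "(real^'m) measure" where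
  "gaussian_noise =
     distr (PiM UNIV (\<lambda>_::'m. density lborel std_normal_density)) borel (\<lambda>e. \<chi> i. e i)"

definition round_kernel ::
  "(real^'d) set \<Rightarrow> (real^'d \<Rightarrow> real^'m^'d) \<Rightarrow>
   (nat \<Rightarrow> (nat \<Rightarrow> (real^'d) \<times> (real^'m)) \<Rightarrow> (real^'d) measure) \<Rightarrow> real^'d \<Rightarrow>
   nat \<Rightarrow> (nat \<Rightarrow> (real^'d) \<times> (real^'m)) \<Rightarrow> ((real^'d) \<times> (real^'m)) measure" where
  "round_kernel X A \<pi> \<theta> t h =
     \<pi> t h \<bind> (\<lambda>x. distr gaussian_noise (round_space X) (\<lambda>e. (x, transpose (A x) *v \<theta> + e)))"

text \<open>
  The law of the first \<open>n\<close> rounds is the iterated composition of the round kernels, started from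
  the empty history.
\<close>

definition history_law ::
  "(real^'d) set \<Rightarrow> (real^'d \<Rightarrow> real^'m^'d) \<Rightarrow>
   (nat \<Rightarrow> (nat \<Rightarrow> (real^'d) \<times> (real^'m)) \<Rightarrow> (real^'d) measure) \<Rightarrow> real^'d \<Rightarrow>
   nat \<Rightarrow> (nat \<Rightarrow> (real^'d) \<times> (real^'m)) measure" where
  "history_law X A \<pi> \<theta> n =
     Ionescu_Tulcea.C (round_kernel X A \<pi> \<theta>) (\<lambda>_. round_space X) 0 n (\<lambda>_. undefined)"

definition best_action :: "(real^'d) set \<Rightarrow> real^'d \<Rightarrow> real^'d" where
  "best_action X \<theta> = (SOME x. x \<in> optimal_actions X \<theta>)"

definition regret ::
  "(real^'d) set \<Rightarrow> real^'d \<Rightarrow> nat \<Rightarrow> (nat \<Rightarrow> (real^'d) \<times> (real^'m)) \<Rightarrow> real" where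
  "regret X \<theta> n h = (\<Sum>t<n. (best_action X \<theta> - fst (h t)) \<bullet> \<theta>)"

definition expected_regret ::
  "(real^'d) set \<Rightarrow> (real^'d \<Rightarrow> real^'m^'d) \<Rightarrow>
   (nat \<Rightarrow> (nat \<Rightarrow> (real^'d) \<times> (real^'m)) \<Rightarrow> (real^'d) measure) \<Rightarrow> real^'d \<Rightarrow> nat \<Rightarrow> real" where
  "expected_regret X A \<pi> \<theta> n = (\<integral>h. regret X \<theta> n h \<partial>history_law X A \<pi> \<theta> n)"

text \<open>
  For a game with diameter at most 1 the expected regret lies in \<open>{0..real n}\<close>
  (\<open>expected_regret_bounds\<close> below) and the set of policies is nonempty (\<open>policies_nonempty\<close>), so
  the infimum and supremum in the reals are the genuine ones.
\<close>

definition minimax_regret ::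
  "(real^'d) set \<Rightarrow> (real^'d \<Rightarrow> real^'m^'d) \<Rightarrow> nat \<Rightarrow> real" where
  "minimax_regret X A n = (INF \<pi>\<in>policies X. SUP \<theta>\<in>cball 0 1. expected_regret X A \<pi> \<theta> n)"

definition soft_bigtheta :: "(nat \<Rightarrow> real) \<Rightarrow> (nat \<Rightarrow> real) set" where
  "soft_bigtheta g =
     {f. \<exists>k::nat. f \<in> O(\<lambda>n. g n * ln (real n) ^ k) \<and> f \<in> \<Omega>(\<lambda>n. g n / ln (real n) ^ k)}"


section \<open>Well-definedness\<close>

lemma best_action_optimal:
  assumes "finite X" "X \<noteq> {}"
  shows "best_action X \<theta> \<in> optimal_actions X \<theta>"
proof -
  have "Max ((\<lambda>y. y \<bullet> \<theta>) ` X) \<in> (\<lambda>y. y \<bullet> \<theta>) ` X"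
    using assms by (intro Max_in) auto
  then have "\<exists>x. x \<in> optimal_actions X \<theta>"
    by (auto simp: optimal_actions_def)
  then show ?thesis
    unfolding best_action_def by (rule someI_ex)
qed

lemma regret_eq_Max:
  assumes "finite X" "X \<noteq> {}"
  shows "regret X \<theta> n h = (\<Sum>t<n. Max ((\<lambda>y. y \<bullet> \<theta>) ` X) - fst (h t) \<bullet> \<theta>)"
  using best_action_optimal[OF assms, of \<theta>]
  by (simp add: regret_def optimal_actions_def inner_diff_left)

lemma instantaneous_regret_bounds:
  assumes "finite X" "diameter X \<le> 1" "\<theta> \<in> cball 0 1" "x \<in> X"
  shows "0 \<le> (best_action X \<theta> - x) \<bullet> \<theta>" "(best_action X \<theta> - x) \<bullet> \<theta> \<le> 1"
proof -
  have opt: "best_action X \<theta> \<in> optimal_actions X \<theta>"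
    using assms by (intro best_action_optimal) auto
  then have *: "best_action X \<theta> \<in> X" "best_action X \<theta> \<bullet> \<theta> = Max ((\<lambda>y. y \<bullet> \<theta>) ` X)"
    by (auto simp: optimal_actions_def)
  have "x \<bullet> \<theta> \<le> Max ((\<lambda>y. y \<bullet> \<theta>) ` X)"
    using assms by (intro Max_ge) auto
  then show "0 \<le> (best_action X \<theta> - x) \<bullet> \<theta>"
    using * by (simp add: inner_diff_left)
  have "norm (best_action X \<theta> - x) \<le> 1"
    using diameter_bounded_bound[OF finite_imp_bounded[OF assms(1)] *(1) assms(4)] assms(2)
    by (simp add: dist_norm)
  moreover have "norm \<theta> \<le> 1"
    using assms(3) by simp
  ultimately have "norm (best_action X \<theta> - x) * norm \<theta> \<le> 1"
    by (simp add: mult_le_one)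
  then show "(best_action X \<theta> - x) \<bullet> \<theta> \<le> 1"
    using norm_cauchy_schwarz[of "best_action X \<theta> - x" \<theta>] by linarith
qed

lemma prob_space_gaussian_noise: "prob_space (gaussian_noise :: (real^'m) measure)"
proof -
  interpret product_prob_space "\<lambda>_::'m. density lborel std_normal_density" UNIV
    by (intro product_prob_spaceI prob_space_normal_density) simp
  have "(\<lambda>e::'m \<Rightarrow> real. \<chi> i. e i) \<in>
      PiM UNIV (\<lambda>_. density lborel std_normal_density) \<rightarrow>\<^sub>M borel"
    by (auto simp: borel_measurable_euclidean_space[where 'c="real^'m"] Basis_vec_def inner_axis)
  then show ?thesis
    unfolding gaussian_noise_def by (rule prob_space.prob_space_distr[OF prob_space_axioms])
qed

lemma round_kernel_measurable:
  fixes A :: "real^'d \<Rightarrow> real^'m^'d"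
  assumes \<pi>: "\<pi> \<in> policies X"
  shows "round_kernel X A \<pi> \<theta> t \<in>
    PiM {0..<t} (\<lambda>_. round_space X) \<rightarrow>\<^sub>M prob_algebra (round_space X)"
proof -
  have [measurable]: "\<pi> t \<in> PiM {0..<t} (\<lambda>_. round_space X) \<rightarrow>\<^sub>M prob_algebra (count_space X)"
    using \<pi> by (simp add: policies_def)
  have "prob_space (distr gaussian_noise (round_space X) (\<lambda>e. (x, transpose (A x) *v \<theta> + e)))"
    if [simp]: "x \<in> X" for x
  proof (rule prob_space.prob_space_distr[OF prob_space_gaussian_noise])
    have [measurable_cong]: "sets (gaussian_noise :: (real^'m) measure) = sets borel"
      by (simp add: gaussian_noise_def)
    show "(\<lambda>e. (x, transpose (A x) *v \<theta> + e)) \<in> gaussian_noise \<rightarrow>\<^sub>M round_space X"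
      by measurable
  qed
  then have [measurable]:
    "(\<lambda>x. distr gaussian_noise (round_space X) (\<lambda>e. (x, transpose (A x) *v \<theta> + e)))
       \<in> count_space X \<rightarrow>\<^sub>M prob_algebra (round_space X)"
    by (simp add: measurable_count_space_eq1 space_prob_algebra Pi_iff)
  show ?thesis
    unfolding round_kernel_def[abs_def] by measurable
qed

lemma Ionescu_Tulcea_round_kernel:
  fixes A :: "real^'d \<Rightarrow> real^'m^'d"
  assumes \<pi>: "\<pi> \<in> policies X"
  shows "Ionescu_Tulcea (round_kernel X A \<pi> \<theta>) (\<lambda>_. round_space X)"
  using measurable_space[OF round_kernel_measurable[OF \<pi>, of A \<theta>]]
  by (auto intro!: Ionescu_Tulcea.intro measurable_prob_algebraD round_kernel_measurable \<pi>
      simp: space_prob_algebra)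

lemma expected_regret_bounds:
  fixes A :: "real^'d \<Rightarrow> real^'m^'d"
  assumes X: "finite X" "diameter X \<le> 1" "\<theta> \<in> cball 0 1" and \<pi>: "\<pi> \<in> policies X"
  shows "prob_space (history_law X A \<pi> \<theta> n)"
    and "integrable (history_law X A \<pi> \<theta> n) (regret X \<theta> n)"
    and "expected_regret X A \<pi> \<theta> n \<in> {0..real n}"
proof -
  interpret IT: Ionescu_Tulcea "round_kernel X A \<pi> \<theta>" "\<lambda>_. round_space X"
    by (rule Ionescu_Tulcea_round_kernel[OF \<pi>])
  let ?H = "history_law X A \<pi> \<theta> n"
  have u: "(\<lambda>_. undefined) \<in> space (PiM {0..<0::nat} (\<lambda>_. round_space X :: ((real^'d) \<times> (real^'m)) measure))"
    by (simp add: space_PiM)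
  show P: "prob_space ?H"
    unfolding history_law_def by (rule IT.prob_space_C[OF u])
  have S: "sets ?H = sets (PiM {0..<n} (\<lambda>_. round_space X))"
    unfolding history_law_def using IT.sets_C[OF u] by simp
  have bounds: "0 \<le> regret X \<theta> n h \<and> regret X \<theta> n h \<le> real n" if "h \<in> space ?H" for h
  proof -
    have "fst (h t) \<in> X" if "t < n" for t
      using \<open>h \<in> space ?H\<close> that
      by (auto simp: sets_eq_imp_space_eq[OF S] space_PiM PiE_iff space_pair_measure mem_Times_iff)
    then have "0 \<le> (best_action X \<theta> - fst (h t)) \<bullet> \<theta> \<and> (best_action X \<theta> - fst (h t)) \<bullet> \<theta> \<le> 1"
      if "t < n" for t
      using instantaneous_regret_bounds[OF X] that by blast
    then show ?thesis
      unfolding regret_def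
      using sum_bounded_above[of "{..<n}" "\<lambda>t. (best_action X \<theta> - fst (h t)) \<bullet> \<theta>" 1]
      by (auto intro!: sum_nonneg)
  qed
  have [measurable]: "regret X \<theta> n \<in> borel_measurable ?H"
  proof -
    have "(\<lambda>h. (best_action X \<theta> - fst (h t)) \<bullet> \<theta>) \<in>
        borel_measurable (PiM {0..<n} (\<lambda>_. round_space X :: ((real^'d) \<times> (real^'m)) measure))"
      if "t < n" for t
    proof -
      have "(\<lambda>h. fst (h t)) \<in>
          PiM {0..<n} (\<lambda>_. round_space X :: ((real^'d) \<times> (real^'m)) measure) \<rightarrow>\<^sub>M count_space X"
        using that by (measurable, simp)
      then show ?thesis
        by (rule measurable_compose) simp
    qed
    then show ?thesis
      unfolding regret_def[abs_def] measurable_cong_sets[OF S refl]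
      by (intro borel_measurable_sum) auto
  qed
  interpret prob_space ?H by (rule P)
  show int: "integrable ?H (regret X \<theta> n)"
    using bounds by (intro integrable_const_bound[where B = "real n"]) auto
  show "expected_regret X A \<pi> \<theta> n \<in> {0..real n}"
    unfolding expected_regret_def
    using bounds integral_le_const[OF int, of "real n"] by (auto intro!: integral_nonneg_AE)
qed

lemma policies_nonempty:
  assumes "X \<noteq> {}"
  shows "(policies X :: (nat \<Rightarrow> (nat \<Rightarrow> (real^'d) \<times> (real^'m)) \<Rightarrow> (real^'d) measure) set) \<noteq> {}"
proof -
  obtain x where "x \<in> X"
    using assms by auto
  then have "(\<lambda>_ _. return (count_space X) x) \<in>
      (policies X :: (nat \<Rightarrow> (nat \<Rightarrow> (real^'d) \<times> (real^'m)) \<Rightarrow> (real^'d) measure) set)"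
    by (auto simp: policies_def space_prob_algebra prob_space_return intro!: measurable_const)
  then show ?thesis
    by blast
qed

end

theory Submission
  imports Defs
begin

text \<open>
  Lower bounds. Tilting the law for a parameter \<open>\<theta>\<close> by a direction \<open>u\<close> and by \<open>-u\<close> gives likelihood
  ratios whose geometric mean is \<open>exp (- q)\<close> with \<open>q\<close> half the sum over the rounds of
  \<open>(norm (transpose (A x) *v u))\<^sup>2\<close>, free of noise. Hence
  \<open>\<theta> + u\<close> and \<open>\<theta> - u\<close> can only be told apart if the expectation of \<open>q\<close> under \<open>\<theta>\<close> is large. For
  \<open>n powr (1/2)\<close> take \<open>\<theta> = 0\<close> and \<open>u\<close> of size \<open>n powr (-1/2)\<close>. If the game is not globally observable,
  some \<open>u\<close> of constant size makes \<open>q\<close> vanish. If it is not locally observable, then already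
  some single \<open>\<theta>\<close> has optimal actions \<open>z\<close>, \<open>w\<close> separated by a \<open>u\<close> invisible to all its optimal actions:
  otherwise \<open>u\<close> would be locally constant on the optimal actions along a convex set. Now \<open>q\<close> grows only
  with the regret under \<open>\<theta>\<close>, and \<open>u\<close> of size \<open>n powr (-1/3)\<close> balances both.

  Upper bounds. Phase \<open>k\<close> plays all actions that are optimal for some parameter in a convex confidence
  set, estimates all their differences up to \<open>\<eta> k\<close>, and shrinks the confidence set accordingly. Every
  action played in phase \<open>k + 1\<close> is then \<open>4 * \<eta> k\<close>-optimal. Local observability is exactly what makes
  the estimates possible in every phase; global observability suffices for the first phase, where the
  confidence set is the whole space, and one then commits.
\<close>

section \<open>Gaussian shift\<close>

abbreviation std_normal :: "real measure" where
  "std_normal \<equiv> density lborel std_normal_density"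

text \<open>Cameron-Martin formula in one dimension: the density at \<open>x - c\<close> is the
  density at \<open>x\<close> times \<open>exp (c * x - c\<^sup>2 / 2)\<close>. With nonnegative
  integrals no integrability condition arises.\<close>

lemma nn_integral_std_normal_shift:
  fixes f :: "real \<Rightarrow> ennreal"
  assumes [measurable]: "f \<in> borel_measurable borel"
  shows "(\<integral>\<^sup>+x. f (x + c) \<partial>std_normal) = (\<integral>\<^sup>+x. ennreal (exp (c * x - c\<^sup>2 / 2)) * f x \<partial>std_normal)"
proof -
  have "std_normal_density (x - c) = std_normal_density x * exp (c * x - c\<^sup>2 / 2)" for x :: real
    by (simp add: std_normal_density_def flip: exp_add) (simp add: power2_eq_square field_simps)
  then have *: "ennreal (std_normal_density (x - c)) = ennreal (std_normal_density x) * ennreal (exp (c * x - c\<^sup>2 / 2))" for x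
    by (simp add: ennreal_mult)
  have "(\<integral>\<^sup>+x. f (x + c) \<partial>std_normal) = (\<integral>\<^sup>+x. ennreal (std_normal_density x) * f (x + c) \<partial>lborel)"
    by (subst nn_integral_density) auto
  also have "\<dots> = (\<integral>\<^sup>+x. ennreal (std_normal_density (x - c)) * f x \<partial>lborel)"
    by (subst nn_integral_real_affine[where c = 1 and t = "-c"]) (auto simp: add.commute)
  also have "\<dots> = (\<integral>\<^sup>+x. ennreal (exp (c * x - c\<^sup>2 / 2)) * f x \<partial>std_normal)"
    by (subst nn_integral_density) (auto simp: * mult.assoc)
  finally show ?thesis .
qed

text \<open>The shifted product measure, and the product measure with the product of the
  one-dimensional weights as density, agree on boxes with the product of the tilted measures
  \<open>?N i\<close>, hence with each other. The exponents add up to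
  \<open>v \<bullet> e - (norm v)\<^sup>2 / 2\<close>.\<close>

lemma nn_integral_gaussian_noise_shift:
  fixes f :: "real^'m \<Rightarrow> ennreal" and v :: "real^'m"
  assumes [measurable]: "f \<in> borel_measurable borel"
  shows "(\<integral>\<^sup>+e. f (e + v) \<partial>gaussian_noise) =
    (\<integral>\<^sup>+e. ennreal (exp (v \<bullet> e - (norm v)\<^sup>2 / 2)) * f e \<partial>gaussian_noise)"
proof -
  let ?G = "PiM UNIV (\<lambda>_::'m. std_normal)"
  let ?w = "\<lambda>i x. ennreal (exp (v $ i * x - (v $ i)\<^sup>2 / 2))"
  let ?N = "\<lambda>i. density std_normal (?w i)"
  interpret std: product_prob_space "\<lambda>_::'m. std_normal" UNIV
    by (intro product_prob_spaceI prob_space_normal_density) simp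
  have emN: "emeasure (?N i) A = emeasure std_normal ((\<lambda>x. x + v $ i) -` A)" if [measurable]: "A \<in> sets borel" for A i
  proof -
    have "emeasure (?N i) A = (\<integral>\<^sup>+x. ?w i x * indicator A x \<partial>std_normal)"
      by (subst emeasure_density) auto
    also have "\<dots> = (\<integral>\<^sup>+x. indicator A (x + v $ i) \<partial>std_normal)"
      by (subst nn_integral_std_normal_shift) auto
    also have "\<dots> = (\<integral>\<^sup>+x. indicator ((\<lambda>x. x + v $ i) -` A) x \<partial>std_normal)"
      by (auto intro!: nn_integral_cong simp: indicator_def)
    also have "\<dots> = emeasure std_normal ((\<lambda>x. x + v $ i) -` A)"
      using measurable_sets_borel[of "\<lambda>x. x + v $ i" borel A] by (subst nn_integral_indicator) auto
    finally show ?thesis .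
  qed
  have "emeasure (?N i) (space (?N i)) = 1" for i
    using emN[of UNIV i] std.prob_space[THEN prob_space.emeasure_space_1] by simp
  then have "prob_space (?N i)" for i
    by (intro prob_spaceI)
  then interpret N: product_prob_space ?N UNIV
    by (intro product_prob_spaceI)
  have setsN: "sets (PiM UNIV ?N) = sets ?G"
    by (intro sets_PiM_cong) auto
  have shift[measurable]: "(\<lambda>e i. e i + v $ i) \<in> ?G \<rightarrow>\<^sub>M ?G"
  proof -
    show ?thesis
      by (rule measurable_PiM_single') (auto simp: space_PiM)
  qed
  have "distr ?G ?G (\<lambda>e i. e i + v $ i) = PiM UNIV ?N"
  proof (rule N.PiM_eqI)
    fix A :: "'m \<Rightarrow> real set" assume A: "\<And>i. i \<in> UNIV \<Longrightarrow> A i \<in> sets (?N i)"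
    then have A'[measurable]: "A i \<in> sets borel" for i by auto
    have "emeasure (distr ?G ?G (\<lambda>e i. e i + v $ i)) (PiE UNIV A) =
        emeasure ?G ((\<lambda>e i. e i + v $ i) -` PiE UNIV A \<inter> space ?G)"
      by (intro emeasure_distr shift) (auto intro!: sets_PiM_I_finite)
    also have "(\<lambda>e i. e i + v $ i) -` PiE UNIV A \<inter> space ?G = PiE UNIV (\<lambda>i. (\<lambda>x. x + v $ i) -` A i)"
      by (auto simp: space_PiM PiE_def)
    also have "emeasure ?G \<dots> = (\<Prod>i\<in>UNIV. emeasure std_normal ((\<lambda>x. x + v $ i) -` A i))"
      using measurable_sets_borel[of "\<lambda>x. x + v $ i" borel "A i" for i]
      by (intro std.emeasure_PiM) auto
    finally show "emeasure (distr ?G ?G (\<lambda>e i. e i + v $ i)) (PiE UNIV A) = (\<Prod>i\<in>UNIV. emeasure (?N i) (A i))"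
      by (simp add: emN)
  qed (auto simp: setsN)
  moreover have dens: "(\<lambda>e. \<Prod>i\<in>UNIV. ?w i (e i)) \<in> borel_measurable ?G"
    by measurable
  have "density ?G (\<lambda>e. \<Prod>i\<in>UNIV. ?w i (e i)) = PiM UNIV ?N"
  proof (rule N.PiM_eqI)
    fix A :: "'m \<Rightarrow> real set" assume A: "\<And>i. i \<in> UNIV \<Longrightarrow> A i \<in> sets (?N i)"
    then have A'[measurable]: "A i \<in> sets borel" for i by auto
    have "emeasure (density ?G (\<lambda>e. \<Prod>i\<in>UNIV. ?w i (e i))) (PiE UNIV A) =
        (\<integral>\<^sup>+e. (\<Prod>i\<in>UNIV. ?w i (e i)) * indicator (PiE UNIV A) e \<partial>?G)"
      by (intro emeasure_density dens) (auto intro!: sets_PiM_I_finite)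
    also have "\<dots> = (\<integral>\<^sup>+e. (\<Prod>i\<in>UNIV. ?w i (e i) * indicator (A i) (e i)) \<partial>?G)"
    proof (intro nn_integral_cong)
      fix e :: "'m \<Rightarrow> real"
      have "indicator (PiE UNIV A) e = (\<Prod>i\<in>UNIV. indicator (A i) (e i) :: ennreal)"
      proof (cases "e \<in> PiE UNIV A")
        case False
        then obtain i where "e i \<notin> A i" by (auto simp: PiE_def)
        then have "(\<Prod>i\<in>UNIV. indicator (A i) (e i) :: ennreal) = 0"
          by (intro prod_zero) (auto intro!: exI[of _ i])
        with False show ?thesis by simp
      qed (auto simp: PiE_def Pi_iff)
      then show "(\<Prod>i\<in>UNIV. ?w i (e i)) * indicator (PiE UNIV A) e = (\<Prod>i\<in>UNIV. ?w i (e i) * indicator (A i) (e i))"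
        by (simp add: prod.distrib)
    qed
    also have "\<dots> = (\<Prod>i\<in>UNIV. \<integral>\<^sup>+x. ?w i x * indicator (A i) x \<partial>std_normal)"
      by (intro std.product_nn_integral_prod) auto
    finally show "emeasure (density ?G (\<lambda>e. \<Prod>i\<in>UNIV. ?w i (e i))) (PiE UNIV A) = (\<Prod>i\<in>UNIV. emeasure (?N i) (A i))"
      by (simp add: emeasure_density)
  qed (auto simp: setsN)
  ultimately have eq: "distr ?G ?G (\<lambda>e i. e i + v $ i) = density ?G (\<lambda>e. \<Prod>i\<in>UNIV. ?w i (e i))"
    by simp
  have vec[measurable]: "(\<lambda>e::'m \<Rightarrow> real. \<chi> i. e i) \<in> ?G \<rightarrow>\<^sub>M borel"
    by (auto simp: borel_measurable_euclidean_space[where 'c="real^'m"] Basis_vec_def inner_axis)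
  have "(\<integral>\<^sup>+e. f (e + v) \<partial>gaussian_noise) = (\<integral>\<^sup>+e. f ((\<chi> i. e i) + v) \<partial>?G)"
    unfolding gaussian_noise_def by (subst nn_integral_distr) auto
  also have "\<dots> = (\<integral>\<^sup>+e. f (\<chi> i. e i + v $ i) \<partial>?G)"
    by (intro nn_integral_cong arg_cong[where f = f]) (simp add: vec_eq_iff)
  also have "\<dots> = (\<integral>\<^sup>+e. f (\<chi> i. e i) \<partial>distr ?G ?G (\<lambda>e i. e i + v $ i))"
    by (subst nn_integral_distr) auto
  also have "\<dots> = (\<integral>\<^sup>+e. (\<Prod>i\<in>UNIV. ?w i (e i)) * f (\<chi> i. e i) \<partial>?G)"
    unfolding eq by (subst nn_integral_density) auto
  also have "\<dots> = (\<integral>\<^sup>+e. ennreal (exp (v \<bullet> (\<chi> i. e i) - (norm v)\<^sup>2 / 2)) * f (\<chi> i. e i) \<partial>?G)"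
  proof (intro nn_integral_cong)
    fix e :: "'m \<Rightarrow> real"
    have "(\<Prod>i\<in>UNIV. ?w i (e i)) = ennreal (\<Prod>i\<in>UNIV. exp (v $ i * e i - (v $ i)\<^sup>2 / 2))"
      by (intro prod_ennreal) auto
    also have "(\<Prod>i\<in>UNIV. exp (v $ i * e i - (v $ i)\<^sup>2 / 2)) = exp (\<Sum>i\<in>UNIV. v $ i * e i - (v $ i)\<^sup>2 / 2)"
      by (simp add: exp_sum)
    also have "(\<Sum>i\<in>UNIV. v $ i * e i - (v $ i)\<^sup>2 / 2) = v \<bullet> (\<chi> i. e i) - (norm v)\<^sup>2 / 2"
      unfolding power2_norm_eq_inner
      by (simp add: sum_subtractf sum_divide_distrib[symmetric] inner_vec_def power2_eq_square)
    finally show "(\<Prod>i\<in>UNIV. ?w i (e i)) * f (\<chi> i. e i) = ennreal (exp (v \<bullet> (\<chi> i. e i) - (norm v)\<^sup>2 / 2)) * f (\<chi> i. e i)"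
      by simp
  qed
  also have "\<dots> = (\<integral>\<^sup>+e. ennreal (exp (v \<bullet> e - (norm v)\<^sup>2 / 2)) * f e \<partial>gaussian_noise)"
    unfolding gaussian_noise_def by (subst nn_integral_distr) auto
  finally show ?thesis .
qed

section \<open>The law of the history\<close>

declare transpose_matrix_vector [simp del]

abbreviation history_space :: "(real^'d) set \<Rightarrow> nat \<Rightarrow> (nat \<Rightarrow> (real^'d) \<times> (real^'m)) measure" where
  "history_space X n \<equiv> PiM {0..<n} (\<lambda>_. round_space X)"

lemma sets_gaussian_noise [measurable_cong, simp]: "sets (gaussian_noise :: (real^'m) measure) = sets borel"
  by (simp add: gaussian_noise_def)

lemma undefined_in_history_space: "(\<lambda>_. undefined) \<in> space (history_space X 0)"
  by (simp add: space_PiM)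

lemma sets_history_law [measurable_cong]:
  assumes "\<pi> \<in> policies X"
  shows "sets (history_law X A \<pi> \<theta> n) = sets (history_space X n)"
proof -
  interpret Ionescu_Tulcea "round_kernel X A \<pi> \<theta>" "\<lambda>_. round_space X"
    by (rule Ionescu_Tulcea_round_kernel[OF assms])
  show ?thesis
    unfolding history_law_def using sets_C[OF undefined_in_history_space] by simp
qed

lemma space_history_law:
  assumes "\<pi> \<in> policies X"
  shows "space (history_law X A \<pi> \<theta> n) = space (history_space X n)"
  by (rule sets_eq_imp_space_eq[OF sets_history_law[OF assms]])

lemma prob_space_history_law:
  assumes "\<pi> \<in> policies X"
  shows "prob_space (history_law X A \<pi> \<theta> n)"
proof -
  interpret Ionescu_Tulcea "round_kernel X A \<pi> \<theta>" "\<lambda>_. round_space X"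
    by (rule Ionescu_Tulcea_round_kernel[OF assms])
  show ?thesis
    unfolding history_law_def by (rule prob_space_C[OF undefined_in_history_space])
qed

lemma policy_kernel:
  assumes "\<pi> \<in> policies X" "h \<in> space (history_space X t)"
  shows "prob_space (\<pi> t h)" "sets (\<pi> t h) = sets (count_space X)" "space (\<pi> t h) = X"
proof -
  have "\<pi> t \<in> history_space X t \<rightarrow>\<^sub>M prob_algebra (count_space X)"
    using assms(1) by (simp add: policies_def)
  from measurable_space[OF this assms(2)]
  have "\<pi> t h \<in> space (prob_algebra (count_space X))" .
  then show "prob_space (\<pi> t h)" "sets (\<pi> t h) = sets (count_space X)"
    by (auto simp: space_prob_algebra)
  then show "space (\<pi> t h) = X"
    by (metis sets_eq_imp_space_eq space_count_space)
qed

lemma nn_integral_round_kernel: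
  fixes A :: "real^'d \<Rightarrow> real^'m^'d"
  assumes \<pi>: "\<pi> \<in> policies X" and h: "h \<in> space (history_space X n)"
    and g[measurable]: "g \<in> borel_measurable (round_space X)"
  shows "(\<integral>\<^sup>+z. g z \<partial>round_kernel X A \<pi> \<theta> n h) =
    (\<integral>\<^sup>+x. \<integral>\<^sup>+e. g (x, transpose (A x) *v \<theta> + e) \<partial>gaussian_noise \<partial>\<pi> n h)"
proof -
  have kernel: "(\<lambda>x. distr gaussian_noise (round_space X) (\<lambda>e. (x, transpose (A x) *v \<theta> + e)))
       \<in> \<pi> n h \<rightarrow>\<^sub>M subprob_algebra (round_space X)"
    unfolding measurable_cong_sets[OF policy_kernel(2)[OF \<pi> h] refl]
    by (auto simp: space_subprob_algebra
        intro!: prob_space_imp_subprob_space prob_space.prob_space_distr[OF prob_space_gaussian_noise])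
  have "(\<integral>\<^sup>+z. g z \<partial>round_kernel X A \<pi> \<theta> n h) =
    (\<integral>\<^sup>+x. \<integral>\<^sup>+z. g z \<partial>distr gaussian_noise (round_space X) (\<lambda>e. (x, transpose (A x) *v \<theta> + e)) \<partial>\<pi> n h)"
    unfolding round_kernel_def by (rule nn_integral_bind[OF g kernel])
  also have "\<dots> = (\<integral>\<^sup>+x. \<integral>\<^sup>+e. g (x, transpose (A x) *v \<theta> + e) \<partial>gaussian_noise \<partial>\<pi> n h)"
    by (intro nn_integral_cong nn_integral_distr)
       (auto simp: policy_kernel[OF \<pi> h])
  finally show ?thesis .
qed

lemma measurable_history_upd:
  assumes "h \<in> space (history_space X n)" "f \<in> history_space X (Suc n) \<rightarrow>\<^sub>M M"
  shows "(\<lambda>z. f (h(n := z))) \<in> round_space X \<rightarrow>\<^sub>M M"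
proof (rule measurable_compose[OF _ assms(2)])
  show "(\<lambda>z. h(n := z)) \<in> round_space X \<rightarrow>\<^sub>M history_space X (Suc n)"
    using assms(1) by (intro measurable_fun_upd[where J = "{0..<n}"]) auto
qed

text \<open>Peels off the last round. Measurability of the inner integral is part of the result
  because an induction over the rounds uses that integral as its new integrand.\<close>

lemma nn_integral_history_law_Suc:
  fixes A :: "real^'d \<Rightarrow> real^'m^'d"
  assumes \<pi>: "\<pi> \<in> policies X"
    and f[measurable]: "f \<in> borel_measurable (history_space X (Suc n))"
  shows "(\<integral>\<^sup>+h. f h \<partial>history_law X A \<pi> \<theta> (Suc n)) =
      (\<integral>\<^sup>+h. \<integral>\<^sup>+x. \<integral>\<^sup>+e. f (h(n := (x, transpose (A x) *v \<theta> + e))) \<partial>gaussian_noise \<partial>\<pi> n h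
        \<partial>history_law X A \<pi> \<theta> n)" (is ?eq)
    and "(\<lambda>h. \<integral>\<^sup>+x. \<integral>\<^sup>+e. f (h(n := (x, transpose (A x) *v \<theta> + e))) \<partial>gaussian_noise \<partial>\<pi> n h)
      \<in> borel_measurable (history_space X n)" (is ?meas)
proof -
  interpret Ionescu_Tulcea "round_kernel X A \<pi> \<theta>" "\<lambda>_. round_space X"
    by (rule Ionescu_Tulcea_round_kernel[OF \<pi>])
  have *: "(\<integral>\<^sup>+h. f h \<partial>eP n h) =
      (\<integral>\<^sup>+x. \<integral>\<^sup>+e. f (h(n := (x, transpose (A x) *v \<theta> + e))) \<partial>gaussian_noise \<partial>\<pi> n h)"
    if "h \<in> space (history_space X n)" for h
    using that f by (simp add: nn_integral_eP nn_integral_round_kernel[OF \<pi>] measurable_history_upd)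
  have "(\<integral>\<^sup>+h. f h \<partial>history_law X A \<pi> \<theta> (Suc n)) =
      (\<integral>\<^sup>+h. \<integral>\<^sup>+h. f h \<partial>eP n h \<partial>history_law X A \<pi> \<theta> n)"
    unfolding history_law_def C.simps add_0
    using measurable_eP[of n] sets_C[OF undefined_in_history_space, of n]
    by (intro nn_integral_bind[OF f]) (simp cong: measurable_cong_sets)
  also have "\<dots> = (\<integral>\<^sup>+h. \<integral>\<^sup>+x. \<integral>\<^sup>+e. f (h(n := (x, transpose (A x) *v \<theta> + e))) \<partial>gaussian_noise \<partial>\<pi> n h
        \<partial>history_law X A \<pi> \<theta> n)"
    by (intro nn_integral_cong *) (simp add: space_history_law[OF \<pi>])
  finally show ?eq .
  have "(\<lambda>h. \<integral>\<^sup>+h. f h \<partial>eP n h) \<in> borel_measurable (history_space X n)"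
    by (rule measurable_compose[OF measurable_eP nn_integral_measurable_subprob_algebra[OF f]])
  then show ?meas
    by (simp add: * cong: measurable_cong)
qed

lemma measurable_history_component:
  assumes "t < n"
  shows "(\<lambda>h. h t) \<in> history_space X n \<rightarrow>\<^sub>M round_space X"
  using assms by (intro measurable_component_singleton) simp

lemma measurable_action:
  assumes "t < n"
  shows "(\<lambda>h. fst (h t)) \<in> history_space X n \<rightarrow>\<^sub>M count_space X"
  by (rule measurable_compose[OF measurable_history_component[OF assms] measurable_fst])

lemma measurable_observation:
  assumes "t < n"
  shows "(\<lambda>h. snd (h t)) \<in> borel_measurable (history_space X n)"
  by (rule measurable_compose[OF measurable_history_component[OF assms] measurable_snd])

lemma measurable_function_of_action:
  fixes g :: "real^'d \<Rightarrow> 'b::topological_space"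
  assumes "t < n"
  shows "(\<lambda>h. g (fst (h t))) \<in> borel_measurable (history_space X n)"
  by (rule measurable_compose[OF measurable_action[OF assms]]) simp

section \<open>Likelihood ratios and exponential martingales\<close>

definition noise :: "(real^'d \<Rightarrow> real^'m^'d) \<Rightarrow> real^'d \<Rightarrow> (real^'d) \<times> (real^'m) \<Rightarrow> real^'m" where
  "noise A \<theta> z = snd z - transpose (A (fst z)) *v \<theta>"

lemma measurable_noise:
  assumes "t < n"
  shows "(\<lambda>h. noise A \<theta> (h t)) \<in> borel_measurable (history_space X n)"
  unfolding noise_def
  by (rule borel_measurable_diff[OF measurable_observation[OF assms]
    measurable_function_of_action[OF assms, where g = "\<lambda>x. transpose (A x) *v \<theta>"]])

text \<open>Logarithm of the likelihood ratio of one round for \<open>\<theta> + u\<close> against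
  \<open>\<theta>\<close>. The choice of the action contributes nothing, as a policy does not see
  the parameter.\<close>

definition log_density :: "(real^'d \<Rightarrow> real^'m^'d) \<Rightarrow> real^'d \<Rightarrow> real^'d \<Rightarrow> (real^'d) \<times> (real^'m) \<Rightarrow> real" where
  "log_density A \<theta> u z = (transpose (A (fst z)) *v u) \<bullet> noise A \<theta> z - (norm (transpose (A (fst z)) *v u))\<^sup>2 / 2"

lemma measurable_log_density:
  assumes "t < n"
  shows "(\<lambda>h. log_density A \<theta> u (h t)) \<in> borel_measurable (history_space X n)"
  unfolding log_density_def
  by (rule borel_measurable_diff[OF
    borel_measurable_inner[OF
      measurable_function_of_action[OF assms, where g = "\<lambda>x. transpose (A x) *v u"]
      measurable_noise[OF assms]]
    measurable_function_of_action[OF assms, where g = "\<lambda>x. (norm (transpose (A x) *v u))\<^sup>2 / 2"]])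

lemma sum_fun_upd_lessThan:
  fixes n :: nat
  shows "(\<Sum>t<n. F ((h(n := z)) t)) = (\<Sum>t<n. F (h t))"
  by (intro sum.cong) auto

text \<open>The likelihood ratio of a history is the product over its rounds. Given the past and the
  action \<open>x\<close>, passing from \<open>\<theta>\<close> to \<open>\<theta> + u\<close>
  merely shifts the Gaussian observation by \<open>transpose (A x) *v u\<close>, so the Gaussian
  shift formula supplies the factor of the last round.\<close>

lemma nn_integral_history_law_shift:
  fixes A :: "real^'d \<Rightarrow> real^'m^'d"
  assumes \<pi>: "\<pi> \<in> policies X"
    and "f \<in> borel_measurable (history_space X n)"
  shows "(\<integral>\<^sup>+h. f h \<partial>history_law X A \<pi> (\<theta> + u) n) =
    (\<integral>\<^sup>+h. ennreal (exp (\<Sum>t<n. log_density A \<theta> u (h t))) * f h \<partial>history_law X A \<pi> \<theta> n)"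
  using assms(2)
proof (induction n arbitrary: f)
  case 0
  have "history_law X A \<pi> (\<theta> + u) 0 = history_law X A \<pi> \<theta> 0"
    using Ionescu_Tulcea_round_kernel[OF \<pi>] by (simp add: history_law_def Ionescu_Tulcea.C.simps)
  then show ?case by simp
next
  case (Suc n)
  note [measurable] = Suc.prems
  let ?v = "\<lambda>x. transpose (A x) *v u"
  let ?upd = "\<lambda>h x e. h(n := (x, transpose (A x) *v \<theta> + e))"
  let ?L = "\<lambda>n h. ennreal (exp (\<Sum>t<n. log_density A \<theta> u (h t)))"
  have upd[measurable]: "(\<lambda>e. f (h(n := (x, y + e)))) \<in> borel_measurable borel"
    if "h \<in> space (history_space X n)" "x \<in> X" for h x y
    using that
    by (intro measurable_compose[OF _ measurable_history_upd[OF that(1) Suc.prems]]) simp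
  have "(\<integral>\<^sup>+h. f h \<partial>history_law X A \<pi> (\<theta> + u) (Suc n)) =
      (\<integral>\<^sup>+h. ?L n h *
        (\<integral>\<^sup>+x. \<integral>\<^sup>+e. f (h(n := (x, transpose (A x) *v (\<theta> + u) + e))) \<partial>gaussian_noise \<partial>\<pi> n h)
        \<partial>history_law X A \<pi> \<theta> n)"
    unfolding nn_integral_history_law_Suc(1)[OF \<pi> Suc.prems]
    by (rule Suc.IH[OF nn_integral_history_law_Suc(2)[OF \<pi> Suc.prems]])
  also have "\<dots> = (\<integral>\<^sup>+h. \<integral>\<^sup>+x. \<integral>\<^sup>+e. ?L (Suc n) (?upd h x e) * f (?upd h x e)
        \<partial>gaussian_noise \<partial>\<pi> n h \<partial>history_law X A \<pi> \<theta> n)"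
  proof (intro nn_integral_cong)
    fix h assume "h \<in> space (history_law X A \<pi> \<theta> n)"
    then have h: "h \<in> space (history_space X n)"
      by (simp add: space_history_law[OF \<pi>])
    have "(\<integral>\<^sup>+e. f (h(n := (x, transpose (A x) *v (\<theta> + u) + e))) \<partial>gaussian_noise) =
        (\<integral>\<^sup>+e. ennreal (exp (?v x \<bullet> e - (norm (?v x))\<^sup>2 / 2)) * f (?upd h x e) \<partial>gaussian_noise)"
      if "x \<in> X" for x
      unfolding nn_integral_gaussian_noise_shift[OF upd[OF h that], symmetric]
      by (simp add: matrix_vector_right_distrib add_ac)
    then have "?L n h * (\<integral>\<^sup>+x. \<integral>\<^sup>+e. f (h(n := (x, transpose (A x) *v (\<theta> + u) + e))) \<partial>gaussian_noise \<partial>\<pi> n h) =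
        ?L n h * (\<integral>\<^sup>+x. \<integral>\<^sup>+e. ennreal (exp (?v x \<bullet> e - (norm (?v x))\<^sup>2 / 2)) * f (?upd h x e) \<partial>gaussian_noise \<partial>\<pi> n h)"
      by (intro arg_cong[where f = "\<lambda>z. _ * z"], intro nn_integral_cong_simp)
         (simp add: policy_kernel[OF \<pi> h] simp_implies_def)
    also have "\<dots> = (\<integral>\<^sup>+x. ?L n h * (\<integral>\<^sup>+e. ennreal (exp (?v x \<bullet> e - (norm (?v x))\<^sup>2 / 2)) * f (?upd h x e) \<partial>gaussian_noise) \<partial>\<pi> n h)"
      by (intro nn_integral_cmult[symmetric])
         (simp add: measurable_cong_sets[OF policy_kernel(2)[OF \<pi> h] refl])
    also have "\<dots> = (\<integral>\<^sup>+x. \<integral>\<^sup>+e. ?L n h * (ennreal (exp (?v x \<bullet> e - (norm (?v x))\<^sup>2 / 2)) * f (?upd h x e)) \<partial>gaussian_noise \<partial>\<pi> n h)"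
      using h by (intro nn_integral_cong nn_integral_cmult[symmetric]) (simp add: policy_kernel[OF \<pi> h])
    also have "\<dots> = (\<integral>\<^sup>+x. \<integral>\<^sup>+e. ?L (Suc n) (?upd h x e) * f (?upd h x e) \<partial>gaussian_noise \<partial>\<pi> n h)"
      by (intro nn_integral_cong)
         (simp add: sum_fun_upd_lessThan log_density_def noise_def exp_add ennreal_mult' mult.assoc)
    finally show "?L n h * (\<integral>\<^sup>+x. \<integral>\<^sup>+e. f (h(n := (x, transpose (A x) *v (\<theta> + u) + e))) \<partial>gaussian_noise \<partial>\<pi> n h) =
        (\<integral>\<^sup>+x. \<integral>\<^sup>+e. ?L (Suc n) (?upd h x e) * f (?upd h x e) \<partial>gaussian_noise \<partial>\<pi> n h)" .
  qed
  also have "\<dots> = (\<integral>\<^sup>+h. ?L (Suc n) h * f h \<partial>history_law X A \<pi> \<theta> (Suc n))"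
    by (intro nn_integral_history_law_Suc(1)[OF \<pi>, symmetric] borel_measurable_times_ennreal measurable_compose[OF _ measurable_ennreal]
        measurable_compose[OF _ borel_measurable_exp] borel_measurable_sum measurable_log_density Suc.prems) simp
  finally show ?case .
qed

text \<open>For a fixed past the last factor integrates to \<open>1\<close>: \<open>v n\<close> does
  not look at round \<open>n\<close>, in particular not at its action, and the Gaussian shift of the
  constant \<open>1\<close> has mass \<open>1\<close>. Predictability is encoded as invariance of
  \<open>v t\<close> under overwriting any round from \<open>t\<close> on.\<close>

lemma nn_integral_exponential_martingale:
  fixes A :: "real^'d \<Rightarrow> real^'m^'d" and v :: "nat \<Rightarrow> (nat \<Rightarrow> (real^'d) \<times> (real^'m)) \<Rightarrow> real^'m"
  assumes \<pi>: "\<pi> \<in> policies X"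
    and v[measurable]: "\<And>t n. t < n \<Longrightarrow> v t \<in> borel_measurable (history_space X n)"
    and predictable: "\<And>t n h z. t \<le> n \<Longrightarrow> v t (h(n := z)) = v t h"
  shows "(\<integral>\<^sup>+h. ennreal (exp (\<Sum>t<n. v t h \<bullet> noise A \<theta> (h t) - (norm (v t h))\<^sup>2 / 2)) \<partial>history_law X A \<pi> \<theta> n) = 1"
proof (induction n)
  case 0
  show ?case
    using prob_space.emeasure_space_1[OF prob_space_history_law[OF \<pi>]] by simp
next
  case (Suc n)
  let ?L = "\<lambda>n h. ennreal (exp (\<Sum>t<n. v t h \<bullet> noise A \<theta> (h t) - (norm (v t h))\<^sup>2 / 2))"
  have meas: "?L n \<in> borel_measurable (history_space X n)" for n
    by (intro measurable_compose[OF _ measurable_ennreal] measurable_compose[OF _ borel_measurable_exp]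
        borel_measurable_sum borel_measurable_diff borel_measurable_inner measurable_noise) auto
  have one: "(\<integral>\<^sup>+e. ennreal (exp (w \<bullet> e - (norm w)\<^sup>2 / 2)) \<partial>gaussian_noise) = 1" for w :: "real^'m"
    using nn_integral_gaussian_noise_shift[of "\<lambda>_. 1" w, symmetric]
    by (simp add: prob_space.emeasure_space_1[OF prob_space_gaussian_noise])
  have "(\<integral>\<^sup>+h. ?L (Suc n) h \<partial>history_law X A \<pi> \<theta> (Suc n)) =
      (\<integral>\<^sup>+h. \<integral>\<^sup>+x. \<integral>\<^sup>+e. ?L (Suc n) (h(n := (x, transpose (A x) *v \<theta> + e))) \<partial>gaussian_noise \<partial>\<pi> n h
        \<partial>history_law X A \<pi> \<theta> n)"
    by (intro nn_integral_history_law_Suc(1)[OF \<pi>] meas)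
  also have "\<dots> = (\<integral>\<^sup>+h. \<integral>\<^sup>+x. \<integral>\<^sup>+e. ?L n h * ennreal (exp (v n h \<bullet> e - (norm (v n h))\<^sup>2 / 2)) \<partial>gaussian_noise \<partial>\<pi> n h
        \<partial>history_law X A \<pi> \<theta> n)"
  proof (intro nn_integral_cong)
    fix h x and e :: "real^'m"
    have "(\<Sum>t<n. v t (h(n := z)) \<bullet> noise A \<theta> ((h(n := z)) t) - (norm (v t (h(n := z))))\<^sup>2 / 2) =
      (\<Sum>t<n. v t h \<bullet> noise A \<theta> (h t) - (norm (v t h))\<^sup>2 / 2)" for z
      by (intro sum.cong) (auto simp: predictable)
    then show "?L (Suc n) (h(n := (x, transpose (A x) *v \<theta> + e))) =
        ?L n h * ennreal (exp (v n h \<bullet> e - (norm (v n h))\<^sup>2 / 2))"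
      by (simp add: predictable exp_add ennreal_mult' noise_def)
  qed
  also have "\<dots> = (\<integral>\<^sup>+h. ?L n h \<partial>history_law X A \<pi> \<theta> n)"
  proof (intro nn_integral_cong)
    fix h assume "h \<in> space (history_law X A \<pi> \<theta> n)"
    then have h: "h \<in> space (history_space X n)"
      by (simp add: space_history_law[OF \<pi>])
    show "(\<integral>\<^sup>+x. \<integral>\<^sup>+e. ?L n h * ennreal (exp (v n h \<bullet> e - (norm (v n h))\<^sup>2 / 2)) \<partial>gaussian_noise \<partial>\<pi> n h) = ?L n h"
      using prob_space.emeasure_space_1[OF policy_kernel(1)[OF \<pi> h]]
      by (simp add: nn_integral_cmult one policy_kernel(3)[OF \<pi> h])
  qed
  finally show ?case using Suc by simp
qed

section \<open>Lower bounds\<close>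

lemma regret_nonneg:
  assumes "finite X" "diameter X \<le> 1" "\<theta> \<in> cball 0 1" "h \<in> space (history_space X n)"
  shows "0 \<le> regret X \<theta> n h"
proof -
  have "fst (h t) \<in> X" if "t < n" for t
    using assms(4) that by (auto simp: space_PiM PiE_iff space_pair_measure mem_Times_iff)
  then show ?thesis
    unfolding regret_def by (intro sum_nonneg instantaneous_regret_bounds(1)[OF assms(1-3)]) auto
qed

lemma measurable_regret: "regret X \<theta> n \<in> borel_measurable (history_space X n)"
  unfolding regret_def[abs_def]
  by (intro borel_measurable_sum measurable_function_of_action[where g = "\<lambda>x. (best_action X \<theta> - x) \<bullet> \<theta>"]) simp

lemma nn_integral_regret:
  assumes "finite X" "diameter X \<le> 1" "\<theta> \<in> cball 0 1" and \<pi>: "\<pi> \<in> policies X"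
  shows "(\<integral>\<^sup>+h. ennreal (regret X \<theta> n h) \<partial>history_law X A \<pi> \<theta> n) = ennreal (expected_regret X A \<pi> \<theta> n)"
  unfolding expected_regret_def
  by (intro nn_integral_eq_integral expected_regret_bounds assms AE_I2 regret_nonneg[OF assms(1-3)])
     (simp add: space_history_law[OF \<pi>])

text \<open>Here \<open>a\<close> and \<open>b\<close> will be the square roots of two likelihood
  ratios. The smaller of them satisfies
  \<open>(min a b)\<^sup>2 * D \<le> a\<^sup>2 * F + b\<^sup>2 * G\<close>, and completing a square
  trades \<open>(min a b)\<^sup>2\<close> for the product \<open>a * b\<close>. The factor
  \<open>1 / 16\<close> keeps the error below the main term once both ratios are integrated to
  \<open>1\<close>.\<close>

lemma weighted_sum_lower_bound:
  fixes a b F G D :: real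
  assumes "0 < a" "0 < b" "0 \<le> F" "0 \<le> G" "0 \<le> D" "D \<le> F + G"
  shows "D / 2 * (a * b) \<le> a\<^sup>2 * F + b\<^sup>2 * G + D / 16 * (a\<^sup>2 + b\<^sup>2)"
proof -
  have "m\<^sup>2 * D \<le> a\<^sup>2 * F + b\<^sup>2 * G" if "0 < m" "m \<le> a" "m \<le> b" for m
  proof -
    have "m\<^sup>2 * D \<le> m\<^sup>2 * F + m\<^sup>2 * G"
      using assms mult_left_mono[of D "F + G" "m\<^sup>2"] by (simp add: distrib_left)
    also have "\<dots> \<le> a\<^sup>2 * F + b\<^sup>2 * G"
      using assms that by (intro add_mono mult_right_mono power_mono) auto
    finally show ?thesis .
  qed
  from this[of "min a b"] have *: "(min a b)\<^sup>2 * D \<le> a\<^sup>2 * F + b\<^sup>2 * G"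
    using assms by auto
  have amgm: "s * t / 2 \<le> s\<^sup>2 + (s\<^sup>2 + t\<^sup>2) / 16" for s t :: real
  proof -
    have "0 \<le> s\<^sup>2 - 2 * s * (t / 4) + t\<^sup>2 / 16"
      using zero_le_power2[of "s - t / 4"] unfolding power2_diff by (simp add: power_divide)
    then show ?thesis
      using zero_le_power2[of s] unfolding add_divide_distrib by linarith
  qed
  have "a * b / 2 \<le> (min a b)\<^sup>2 + (a\<^sup>2 + b\<^sup>2) / 16"
    using amgm[of a b] amgm[of b a] by (auto simp: min_def mult.commute add.commute)
  from mult_left_mono[OF this \<open>0 \<le> D\<close>]
  have "D / 2 * (a * b) \<le> (min a b)\<^sup>2 * D + D / 16 * (a\<^sup>2 + b\<^sup>2)"
    by (simp add: field_simps)
  with * show ?thesis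
    by linarith
qed

text \<open>The inner products with the noise are odd in \<open>u\<close> and cancel; the quadratic
  terms are even and add up.\<close>

lemma sum_log_density_opposite:
  fixes A :: "real^'d \<Rightarrow> real^'m^'d" and u :: "real^'d" and n :: nat
  shows "(\<Sum>t<n. log_density A \<theta> u (h t)) + (\<Sum>t<n. log_density A \<theta> (-u) (h t)) =
    - (\<Sum>t<n. (norm (transpose (A (fst (h t))) *v u))\<^sup>2)"
proof -
  have "M *v (- u) = - (M *v u)" for M :: "real^'d^'m"
    by (metis matrix_vector_mult_scaleR scaleR_minus1_left)
  then have "log_density A \<theta> u z + log_density A \<theta> (-u) z = - (norm (transpose (A (fst z)) *v u))\<^sup>2" for z
    by (simp add: log_density_def)
  then show ?thesis
    by (simp add: sum.distrib[symmetric] sum_negf)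
qed

text \<open>Both laws are expressed by likelihood ratios against the law for
  \<open>\<theta>\<close>, whose square roots \<open>?a\<close> and \<open>?b\<close> have product
  \<open>exp (- q h)\<close>. Integrating the weighted pointwise inequality gives the main term
  \<open>D / 2\<close>; the two ratios have mass \<open>1\<close> each and cost
  \<open>D / 8\<close>, which leaves \<open>3 / 8 * D\<close>.\<close>

lemma two_point_lower_bound:
  fixes A :: "real^'d \<Rightarrow> real^'m^'d" and \<theta> u :: "real^'d"
  assumes \<pi>: "\<pi> \<in> policies X"
    and F[measurable]: "F \<in> borel_measurable (history_space X n)" "G \<in> borel_measurable (history_space X n)"
    and nonneg: "\<And>h. h \<in> space (history_space X n) \<Longrightarrow> 0 \<le> F h"
      "\<And>h. h \<in> space (history_space X n) \<Longrightarrow> 0 \<le> G h"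
    and D: "0 \<le> D" "\<And>h. h \<in> space (history_space X n) \<Longrightarrow> D \<le> F h + G h"
  defines "q \<equiv> \<lambda>h. (\<Sum>t<n. (norm (transpose (A (fst (h t))) *v u))\<^sup>2) / 2"
  shows "ennreal (3 / 8 * D) \<le>
    (\<integral>\<^sup>+h. F h \<partial>history_law X A \<pi> (\<theta> + u) n) + (\<integral>\<^sup>+h. G h \<partial>history_law X A \<pi> (\<theta> - u) n)
      + ennreal (D / 2) * (\<integral>\<^sup>+h. q h \<partial>history_law X A \<pi> \<theta> n)"
proof -
  note [measurable_cong] = sets_history_law[OF \<pi>]
  let ?P = "history_law X A \<pi> \<theta> n"
  let ?L = "\<lambda>u h. exp (\<Sum>t<n. log_density A \<theta> u (h t))"
  have L[measurable]: "(\<lambda>h. ennreal (?L u h)) \<in> borel_measurable (history_space X n)" for u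
    by (intro measurable_compose[OF _ measurable_ennreal] measurable_compose[OF _ borel_measurable_exp]
        borel_measurable_sum measurable_log_density) simp
  have L': "(\<lambda>h. ennreal (?L u h)) \<in> borel_measurable ?P" for u
    unfolding measurable_cong_sets[OF sets_history_law[OF \<pi>] refl] by (rule L)
  have q[measurable]: "q \<in> borel_measurable (history_space X n)"
    unfolding q_def
    by (intro borel_measurable_divide borel_measurable_sum borel_measurable_const
      measurable_function_of_action[where g = "\<lambda>x. (norm (transpose (A x) *v u))\<^sup>2"]) simp
  have one: "(\<integral>\<^sup>+h. 1 \<partial>history_law X A \<pi> \<theta>' n) = 1" for \<theta>'
    using prob_space.emeasure_space_1[OF prob_space_history_law[OF \<pi>]] by simp
  have L1: "(\<integral>\<^sup>+h. ennreal (?L u h) \<partial>?P) = 1" for u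
    using nn_integral_history_law_shift[OF \<pi>, of "\<lambda>_. 1" n A \<theta> u] one by simp
  have ennreal_expand: "ennreal (a * f + b * g + c * (a + b) + d * r) =
      ennreal a * ennreal f + ennreal b * ennreal g + ennreal c * (ennreal a + ennreal b) + ennreal d * ennreal r"
    if "0 \<le> a" "0 \<le> b" "0 \<le> c" "0 \<le> d" "0 \<le> f" "0 \<le> g" "0 \<le> r" for a b c d f g r :: real
    using that by (simp add: ennreal_mult)
  have pointwise: "ennreal (D / 2) \<le>
      ennreal (?L u h) * ennreal (F h) + ennreal (?L (-u) h) * ennreal (G h)
      + ennreal (D / 16) * (ennreal (?L u h) + ennreal (?L (-u) h)) + ennreal (D / 2) * ennreal (q h)"
    if h: "h \<in> space (history_space X n)" for h
  proof -
    let ?a = "exp ((\<Sum>t<n. log_density A \<theta> u (h t)) / 2)"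
    let ?b = "exp ((\<Sum>t<n. log_density A \<theta> (-u) (h t)) / 2)"
    have q0: "0 \<le> q h"
      by (simp add: q_def sum_nonneg)
    have ab: "?a\<^sup>2 = ?L u h" "?b\<^sup>2 = ?L (-u) h"
      by (simp_all add: exp_double[symmetric])
    have "?a * ?b = exp (- q h)"
      unfolding exp_add[symmetric] add_divide_distrib[symmetric] sum_log_density_opposite
      by (simp add: q_def)
    then have "D / 2 * exp (- q h) \<le> ?L u h * F h + ?L (-u) h * G h + D / 16 * (?L u h + ?L (-u) h)"
      using weighted_sum_lower_bound[of ?a ?b "F h" "G h" D] nonneg[OF h] D(1) D(2)[OF h] ab by simp
    \<comment> \<open>The linear minorant of the exponential makes the bound depend on
      \<open>q\<close> only through its expectation under \<open>\<theta>\<close>.\<close>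
    moreover have "D / 2 * (1 - q h) \<le> D / 2 * exp (- q h)"
      using exp_ge_add_one_self[of "- q h"] D(1) by (intro mult_left_mono) auto
    ultimately have "D / 2 \<le> ?L u h * F h + ?L (-u) h * G h + D / 16 * (?L u h + ?L (-u) h) + D / 2 * q h"
      by (simp add: algebra_simps)
    then have "ennreal (D / 2) \<le> ennreal (?L u h * F h + ?L (-u) h * G h + D / 16 * (?L u h + ?L (-u) h) + D / 2 * q h)"
      by (rule ennreal_leI)
    also have "\<dots> = ennreal (?L u h) * ennreal (F h) + ennreal (?L (-u) h) * ennreal (G h)
      + ennreal (D / 16) * (ennreal (?L u h) + ennreal (?L (-u) h)) + ennreal (D / 2) * ennreal (q h)"
      using nonneg[OF h] D(1) q0 by (intro ennreal_expand) auto
    finally show ?thesis .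
  qed
  have "ennreal (D / 2) = (\<integral>\<^sup>+h. ennreal (D / 2) \<partial>?P)"
    using prob_space.emeasure_space_1[OF prob_space_history_law[OF \<pi>]] by simp
  also have "\<dots> \<le> (\<integral>\<^sup>+h. ennreal (?L u h) * ennreal (F h) + ennreal (?L (-u) h) * ennreal (G h)
      + ennreal (D / 16) * (ennreal (?L u h) + ennreal (?L (-u) h)) + ennreal (D / 2) * ennreal (q h) \<partial>?P)"
    by (intro nn_integral_mono pointwise) (simp add: space_history_law[OF \<pi>])
  also have "\<dots> = (\<integral>\<^sup>+h. ennreal (?L u h) * ennreal (F h) \<partial>?P) + (\<integral>\<^sup>+h. ennreal (?L (-u) h) * ennreal (G h) \<partial>?P)
      + ennreal (D / 16) * ((\<integral>\<^sup>+h. ennreal (?L u h) \<partial>?P) + (\<integral>\<^sup>+h. ennreal (?L (-u) h) \<partial>?P))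
      + ennreal (D / 2) * (\<integral>\<^sup>+h. q h \<partial>?P)"
    by (simp add: nn_integral_add nn_integral_cmult nn_integral_add[OF L' L'])
  also have "\<dots> = (\<integral>\<^sup>+h. F h \<partial>history_law X A \<pi> (\<theta> + u) n) + (\<integral>\<^sup>+h. G h \<partial>history_law X A \<pi> (\<theta> - u) n)
      + ennreal (D / 2) * (\<integral>\<^sup>+h. q h \<partial>?P) + ennreal (D / 8)"
    using nn_integral_history_law_shift[OF \<pi>, of "\<lambda>h. ennreal (F h)" n A \<theta> u]
      nn_integral_history_law_shift[OF \<pi>, of "\<lambda>h. ennreal (G h)" n A \<theta> "-u"] D(1)
      ennreal_mult[of "D / 16" 2]
    by (simp add: L1 ac_simps)
  finally have "ennreal (D / 2) \<le> \<dots>" .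
  moreover have "ennreal (D / 2) = ennreal (3 / 8 * D) + ennreal (D / 8)"
    using D(1) by (simp add: ennreal_plus[symmetric] del: ennreal_plus)
  ultimately show ?thesis
    by (simp add: ennreal_add_left_cancel_le add.commute[of _ "ennreal (D / 8)"])
qed

text \<open>In every round the gaps for \<open>\<theta> + u\<close> and \<open>\<theta> - u\<close>
  add up to at least \<open>c\<close>, whatever is played, so the two-point bound applies with
  \<open>D = real n * c\<close>. Through \<open>info\<close>, the expectation of \<open>q\<close> is
  controlled by the regret under \<open>\<theta>\<close>: \<open>\<kappa>\<close> prices information
  paid for by regret, \<open>\<beta>\<close> bounds information that is free. All three expected
  regrets are at most the worst case \<open>?R\<close>, and the resulting inequality is linear in
  \<open>?R\<close>.\<close>

lemma minimax_regret_ge: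
  fixes A :: "real^'d \<Rightarrow> real^'m^'d"
  assumes X: "finite X" "X \<noteq> {}" "diameter X \<le> 1"
    and \<theta>: "\<theta> \<in> cball 0 1" "\<theta> + u \<in> cball 0 1" "\<theta> - u \<in> cball 0 1"
    and zw: "z \<in> optimal_actions X \<theta>" "w \<in> optimal_actions X \<theta>" "0 \<le> c" "c \<le> (z - w) \<bullet> u"
    and info: "0 \<le> \<kappa>" "0 \<le> \<beta>"
      "\<And>x. x \<in> X \<Longrightarrow> (norm (transpose (A x) *v u))\<^sup>2 \<le> \<kappa> * ((best_action X \<theta> - x) \<bullet> \<theta>) + \<beta>"
  shows "real n * c * (3 / 8 - real n * \<beta> / 4) / (2 + real n * c * \<kappa> / 4) \<le> minimax_regret X A n"
  unfolding minimax_regret_def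
proof (rule cINF_greatest)
  show "(policies X :: (nat \<Rightarrow> (nat \<Rightarrow> (real^'d) \<times> (real^'m)) \<Rightarrow> (real^'d) measure) set) \<noteq> {}"
    using X by (intro policies_nonempty)
  fix \<pi> :: "nat \<Rightarrow> (nat \<Rightarrow> (real^'d) \<times> (real^'m)) \<Rightarrow> (real^'d) measure"
  assume \<pi>: "\<pi> \<in> policies X"
  note [measurable_cong] = sets_history_law[OF \<pi>]
  let ?R = "SUP \<theta>\<in>cball 0 1. expected_regret X A \<pi> \<theta> n"
  have le: "expected_regret X A \<pi> \<theta>' n \<le> ?R" if "\<theta>' \<in> cball 0 1" for \<theta>'
    using expected_regret_bounds(3)[OF X(1,3) _ \<pi>, of _ A n]
    by (intro cSUP_upper[OF that] bdd_aboveI2[where M = "real n"]) auto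
  let ?gap = "\<lambda>\<theta> x. (best_action X \<theta> - x) \<bullet> \<theta>"
  have gap_ge: "(y - x) \<bullet> \<theta>' \<le> ?gap \<theta>' x" if "y \<in> X" for x y \<theta>'
    using best_action_optimal[OF X(1,2), of \<theta>'] X that
    by (simp add: optimal_actions_def inner_diff_left)
  have gap_eq: "(y - x) \<bullet> \<theta> = ?gap \<theta> x" if "y \<in> optimal_actions X \<theta>" for x y
    using best_action_optimal[OF X(1,2), of \<theta>] that
    by (simp add: optimal_actions_def inner_diff_left)
  have in_X: "fst (h t) \<in> X" if "h \<in> space (history_space X n)" "t < n" for h t
    using that by (auto simp: space_PiM PiE_iff space_pair_measure mem_Times_iff)
  have sum_gap: "c \<le> ?gap (\<theta> + u) x + ?gap (\<theta> - u) x" if "x \<in> X" for x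
  proof -
    \<comment> \<open>\<open>z\<close> is compared with \<open>x\<close> under
      \<open>\<theta> + u\<close>, and \<open>w\<close> under \<open>\<theta> - u\<close>; the parts
      along \<open>\<theta>\<close> give the gap of \<open>x\<close> twice, which is
      nonnegative.\<close>
    have "c \<le> 2 * ?gap \<theta> x + (z - w) \<bullet> u"
      using zw(4) instantaneous_regret_bounds(1)[OF X(1,3) \<theta>(1) that] by linarith
    also have "\<dots> = (z - x) \<bullet> (\<theta> + u) + (w - x) \<bullet> (\<theta> - u)"
      using gap_eq[OF zw(1), of x] gap_eq[OF zw(2), of x] by (simp add: inner_add_right inner_diff_right inner_diff_left)
    also have "\<dots> \<le> ?gap (\<theta> + u) x + ?gap (\<theta> - u) x"
      using zw by (intro add_mono gap_ge) (auto simp: optimal_actions_def)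
    finally show ?thesis .
  qed
  have D: "real n * c \<le> regret X (\<theta> + u) n h + regret X (\<theta> - u) n h"
    if "h \<in> space (history_space X n)" for h
    using sum_mono[of "{..<n}" "\<lambda>_. c" "\<lambda>t. ?gap (\<theta> + u) (fst (h t)) + ?gap (\<theta> - u) (fst (h t))"]
      sum_gap[OF in_X[OF that]]
    by (simp add: regret_def sum.distrib)
  let ?q = "\<lambda>h. (\<Sum>t<n. (norm (transpose (A (fst (h t))) *v u))\<^sup>2) / 2"
  have q_le: "?q h \<le> (\<kappa> * regret X \<theta> n h + real n * \<beta>) / 2" if "h \<in> space (history_space X n)" for h
    using sum_mono[of "{..<n}" "\<lambda>t. (norm (transpose (A (fst (h t))) *v u))\<^sup>2" "\<lambda>t. \<kappa> * ?gap \<theta> (fst (h t)) + \<beta>"]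
      info(3)[OF in_X[OF that]]
    by (simp add: regret_def sum.distrib sum_distrib_left)
  have meas: "(\<lambda>h. ennreal (regret X \<theta> n h)) \<in> borel_measurable (history_law X A \<pi> \<theta> n)"
    using measurable_regret[of X \<theta> n] by measurable
  have "(\<integral>\<^sup>+h. ?q h \<partial>history_law X A \<pi> \<theta> n) \<le>
      (\<integral>\<^sup>+h. ennreal (\<kappa> / 2) * ennreal (regret X \<theta> n h) + ennreal (real n * \<beta> / 2) \<partial>history_law X A \<pi> \<theta> n)"
  proof (intro nn_integral_mono)
    fix h assume "h \<in> space (history_law X A \<pi> \<theta> n)"
    then have h: "h \<in> space (history_space X n)"
      by (simp add: space_history_law[OF \<pi>])
    have "ennreal (?q h) \<le> ennreal (\<kappa> / 2 * regret X \<theta> n h + real n * \<beta> / 2)"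
      using q_le[OF h] by (intro ennreal_leI) (simp add: add_divide_distrib)
    also have "\<dots> = ennreal (\<kappa> / 2) * ennreal (regret X \<theta> n h) + ennreal (real n * \<beta> / 2)"
      using info(1,2) regret_nonneg[OF X(1,3) \<theta>(1) h]
      by (subst ennreal_plus; (subst ennreal_mult)?) auto
    finally show "ennreal (?q h) \<le> \<dots>" .
  qed
  also have "\<dots> = ennreal (\<kappa> / 2) * ennreal (expected_regret X A \<pi> \<theta> n) + ennreal (real n * \<beta> / 2)"
    using prob_space.emeasure_space_1[OF prob_space_history_law[OF \<pi>], of A \<theta> n]
    unfolding nn_integral_add[OF borel_measurable_times_ennreal[OF borel_measurable_const meas] borel_measurable_const]
      nn_integral_cmult[OF meas] nn_integral_regret[OF X(1,3) \<theta>(1) \<pi>]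
    by simp
  also have "\<dots> = ennreal (\<kappa> / 2 * expected_regret X A \<pi> \<theta> n + real n * \<beta> / 2)"
    using info(1,2) expected_regret_bounds(3)[OF X(1,3) \<theta>(1) \<pi>, of A n]
    by (subst ennreal_plus; (subst ennreal_mult)?) auto
  also have "\<dots> \<le> ennreal (\<kappa> / 2 * ?R + real n * \<beta> / 2)"
    using info(1) le[OF \<theta>(1)] by (intro ennreal_leI add_right_mono mult_left_mono) auto
  finally have q: "(\<integral>\<^sup>+h. ?q h \<partial>history_law X A \<pi> \<theta> n) \<le> ennreal (\<kappa> / 2 * ?R + real n * \<beta> / 2)" .
  have R0: "0 \<le> ?R"
    using le[OF \<theta>(1)] expected_regret_bounds(3)[OF X(1,3) \<theta>(1) \<pi>, of A n] by simp
  have nc: "0 \<le> real n * c"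
    using zw(3) by simp
  have ennreal_expand: "ennreal r + ennreal r + ennreal a * ennreal b = ennreal (r + r + a * b)"
    if "0 \<le> r" "0 \<le> a" "0 \<le> b" for r a b :: real
    using that by (simp only: ennreal_plus ennreal_mult add_nonneg_nonneg mult_nonneg_nonneg)
  have "ennreal (3 / 8 * (real n * c)) \<le>
    (\<integral>\<^sup>+h. regret X (\<theta> + u) n h \<partial>history_law X A \<pi> (\<theta> + u) n)
      + (\<integral>\<^sup>+h. regret X (\<theta> - u) n h \<partial>history_law X A \<pi> (\<theta> - u) n)
      + ennreal (real n * c / 2) * (\<integral>\<^sup>+h. ?q h \<partial>history_law X A \<pi> \<theta> n)"
    by (rule two_point_lower_bound[OF \<pi> measurable_regret measurable_regret regret_nonneg regret_nonneg nc D])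
       (use X \<theta> in auto)
  also have "\<dots> \<le> ennreal ?R + ennreal ?R + ennreal (real n * c / 2) * ennreal (\<kappa> / 2 * ?R + real n * \<beta> / 2)"
    unfolding nn_integral_regret[OF X(1,3) \<theta>(2) \<pi>] nn_integral_regret[OF X(1,3) \<theta>(3) \<pi>]
    by (intro add_mono ennreal_leI le \<theta> mult_left_mono q) simp
  also have "\<dots> = ennreal (?R + ?R + real n * c / 2 * (\<kappa> / 2 * ?R + real n * \<beta> / 2))"
    using R0 nc info(1,2) by (intro ennreal_expand) auto
  finally have "3 / 8 * (real n * c) \<le> ?R + ?R + real n * c / 2 * (\<kappa> / 2 * ?R + real n * \<beta> / 2)"
    using R0 nc info(1,2) by (subst (asm) ennreal_le_iff) auto
  then have "real n * c * (3 / 8 - real n * \<beta> / 4) \<le> ?R * (2 + real n * c * \<kappa> / 4)"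
    by (simp add: algebra_simps)
  moreover have "0 < 2 + real n * c * \<kappa> / 4"
    using nc info(1) by (intro add_pos_nonneg) auto
  ultimately show "real n * c * (3 / 8 - real n * \<beta> / 4) / (2 + real n * c * \<kappa> / 4) \<le> ?R"
    by (simp add: pos_divide_le_eq)
qed

section \<open>Optimal actions and unobservable directions\<close>

lemma optimal_actions_iff:
  assumes "finite X"
  shows "x \<in> optimal_actions X \<theta> \<longleftrightarrow> x \<in> X \<and> (\<forall>y\<in>X. y \<bullet> \<theta> \<le> x \<bullet> \<theta>)"
proof (cases "x \<in> X")
  case True
  then have "x \<bullet> \<theta> = Max ((\<lambda>y. y \<bullet> \<theta>) ` X) \<longleftrightarrow> (\<forall>y\<in>X. y \<bullet> \<theta> \<le> x \<bullet> \<theta>)"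
    using assms by (subst eq_commute, subst Max_eq_iff) auto
  with True show ?thesis by (simp add: optimal_actions_def)
qed (simp add: optimal_actions_def)

lemma optimal_actions_0: "finite X \<Longrightarrow> optimal_actions X 0 = X"
  by (auto simp: optimal_actions_iff)

lemma optimal_actions_scaleR:
  assumes "finite X" "0 < c"
  shows "optimal_actions X (c *\<^sub>R \<theta>) = optimal_actions X \<theta>"
  using assms by (auto simp: optimal_actions_iff)

text \<open>Upper semicontinuity of the set of maximisers: each of the finitely many other actions
  loses strictly to \<open>?b\<close> at \<open>\<theta>\<close>, and a strict inequality persists
  nearby.\<close>

lemma eventually_optimal_actions_subset:
  assumes "finite X" "X \<noteq> {}"
  shows "\<forall>\<^sub>F \<theta>' in at \<theta> within S. optimal_actions X \<theta>' \<subseteq> optimal_actions X \<theta>"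
proof -
  let ?b = "best_action X \<theta>"
  have b: "?b \<in> X" "\<And>y. y \<in> X \<Longrightarrow> y \<bullet> \<theta> \<le> ?b \<bullet> \<theta>"
    using best_action_optimal[OF assms, of \<theta>] assms by (auto simp: optimal_actions_iff)
  have "\<forall>\<^sub>F \<theta>' in at \<theta> within S. x \<bullet> \<theta>' < ?b \<bullet> \<theta>'" if "x \<in> X - optimal_actions X \<theta>" for x
  proof -
    have "\<exists>y\<in>X. x \<bullet> \<theta> < y \<bullet> \<theta>"
      using that assms by (auto simp: optimal_actions_iff not_le)
    then have "0 < (?b - x) \<bullet> \<theta>"
      using b(2) by (force simp: inner_diff_left)
    moreover have "((\<lambda>\<theta>'. (?b - x) \<bullet> \<theta>') \<longlongrightarrow> (?b - x) \<bullet> \<theta>) (at \<theta> within S)"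
      by (intro tendsto_intros)
    ultimately have "\<forall>\<^sub>F \<theta>' in at \<theta> within S. 0 < (?b - x) \<bullet> \<theta>'"
      by (simp add: order_tendstoD(1))
    then show ?thesis by (simp add: inner_diff_left)
  qed
  then have "\<forall>\<^sub>F \<theta>' in at \<theta> within S. \<forall>x\<in>X - optimal_actions X \<theta>. x \<bullet> \<theta>' < ?b \<bullet> \<theta>'"
    using assms by (intro eventually_ball_finite) auto
  then show ?thesis
  proof (rule eventually_mono)
    fix \<theta>' assume less: "\<forall>x\<in>X - optimal_actions X \<theta>. x \<bullet> \<theta>' < ?b \<bullet> \<theta>'"
    show "optimal_actions X \<theta>' \<subseteq> optimal_actions X \<theta>"
    proof
      fix x assume "x \<in> optimal_actions X \<theta>'"
      then have "x \<in> X" "?b \<bullet> \<theta>' \<le> x \<bullet> \<theta>'"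
        using b(1) assms(1) by (auto simp: optimal_actions_iff)
      then show "x \<in> optimal_actions X \<theta>"
        using less by (metis DiffI not_le)
    qed
  qed
qed

text \<open>\<open>u\<close> is a multiple of the component \<open>r\<close> of \<open>x - y\<close>
  orthogonal to the span, and \<open>(x - y) \<bullet> r\<close> is the squared norm of
  \<open>r\<close>. The length \<open>1 / 2\<close> leaves room in the unit ball for a base point of
  norm at most \<open>1 / 2\<close>.\<close>

lemma unobservable_direction:
  fixes A :: "real^'d \<Rightarrow> real^'m^'d"
  assumes "x - y \<notin> feedback_span A Y"
  obtains u where "norm u = 1 / 2" "0 < (x - y) \<bullet> u" "\<And>z. z \<in> Y \<Longrightarrow> transpose (A z) *v u = 0"
proof -
  let ?S = "\<Union>z\<in>Y. columns (A z)"
  obtain p r where pr: "p \<in> span ?S" "\<And>w. w \<in> span ?S \<Longrightarrow> orthogonal r w" "x - y = p + r"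
    using orthogonal_subspace_decomp_exists[of ?S "x - y"] by blast
  have r: "r \<noteq> 0"
    using pr assms by (auto simp: feedback_span_def)
  have "p \<bullet> r = 0"
    using pr(2)[OF pr(1)] by (simp add: orthogonal_def inner_commute)
  then have pos: "0 < (x - y) \<bullet> r"
    using r by (simp add: pr(3) inner_add_left)
  have "transpose (A z) *v r = 0" if "z \<in> Y" for z
  proof -
    have "column i (A z) \<bullet> r = 0" for i
    proof -
      have "column i (A z) \<in> span ?S"
        using that by (intro span_base) (auto simp: columns_def)
      then show ?thesis
        using pr(2)[of "column i (A z)"] by (simp add: orthogonal_def inner_commute)
    qed
    then show ?thesis
      by (simp add: vec_eq_iff matrix_vector_mult_def transpose_def column_def inner_vec_def)
  qed
  then show thesis
    using r pos by (intro that[of "(1 / (2 * norm r)) *\<^sub>R r"]) (simp_all add: matrix_vector_mult_scaleR)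
qed

text \<open>Failure on a convex set is traced to a single parameter. If \<open>u\<close> were
  constant on the optimal actions of each parameter in \<open>C\<close>, semicontinuity would make
  this value locally constant along \<open>C\<close>, hence constant as \<open>C\<close> is
  connected, whereas \<open>u\<close> separates \<open>x\<close> from \<open>y\<close>.\<close>

lemma not_locally_observable_witness:
  fixes A :: "real^'d \<Rightarrow> real^'m^'d"
  assumes X: "finite X" "X \<noteq> {}" and "\<not> locally_observable X A"
  obtains \<theta> z w u where "norm \<theta> \<le> 1 / 2" "norm u = 1 / 2"
    "z \<in> optimal_actions X \<theta>" "w \<in> optimal_actions X \<theta>" "0 < (z - w) \<bullet> u"
    "\<And>x. x \<in> optimal_actions X \<theta> \<Longrightarrow> transpose (A x) *v u = 0"
proof -
  obtain C x y where C: "convex C" "x \<in> optimal_actions_on X C" "y \<in> optimal_actions_on X C"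
    "x - y \<notin> feedback_span A (optimal_actions_on X C)"
    using assms(3) by (auto simp: locally_observable_def)
  obtain u where u: "norm u = 1 / 2" "0 < (x - y) \<bullet> u"
    "\<And>z. z \<in> optimal_actions_on X C \<Longrightarrow> transpose (A z) *v u = 0"
    using unobservable_direction[OF C(4)] by blast
  obtain \<theta>0 \<theta>1 where \<theta>01: "\<theta>0 \<in> C" "x \<in> optimal_actions X \<theta>0" "\<theta>1 \<in> C" "y \<in> optimal_actions X \<theta>1"
    using C(2,3) by (auto simp: optimal_actions_on_def)
  have "\<exists>\<theta>\<in>C. \<exists>z\<in>optimal_actions X \<theta>. \<exists>w\<in>optimal_actions X \<theta>. z \<bullet> u \<noteq> w \<bullet> u"
  proof (rule ccontr)
    assume "\<not> ?thesis"
    then have const: "z \<bullet> u = w \<bullet> u"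
      if "\<theta> \<in> C" "z \<in> optimal_actions X \<theta>" "w \<in> optimal_actions X \<theta>" for \<theta> z w
      using that by blast
    let ?f = "\<lambda>\<theta>. best_action X \<theta> \<bullet> u"
    have "?f \<theta>0 = ?f \<theta>1"
    proof (rule connected_local_const[OF convex_connected[OF C(1)] \<theta>01(1,3)], intro ballI)
      fix \<theta> assume \<theta>: "\<theta> \<in> C"
      show "\<forall>\<^sub>F \<theta>' in at \<theta> within C. ?f \<theta> = ?f \<theta>'"
        using eventually_optimal_actions_subset[OF X, of \<theta> C]
      proof eventually_elim
        case (elim \<theta>')
        then show ?case
          using best_action_optimal[OF X] by (intro const[OF \<theta>]) auto
      qed
    qed
    then have "x \<bullet> u = y \<bullet> u"
      using const[OF \<theta>01(1,2) best_action_optimal[OF X]] const[OF \<theta>01(3,4) best_action_optimal[OF X]] by simp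
    then show False
      using u(2) by (simp add: inner_diff_left)
  qed
  then have "\<exists>\<theta>\<in>C. \<exists>z\<in>optimal_actions X \<theta>. \<exists>w\<in>optimal_actions X \<theta>. w \<bullet> u < z \<bullet> u"
    unfolding neq_iff by blast
  then obtain \<theta> z w where \<theta>: "\<theta> \<in> C" "z \<in> optimal_actions X \<theta>" "w \<in> optimal_actions X \<theta>" "0 < (z - w) \<bullet> u"
    by (auto simp: inner_diff_left)
  \<comment> \<open>Rescaling does not change the optimal actions; the summand \<open>1\<close>
    keeps the factor positive when \<open>\<theta> = 0\<close>.\<close>
  define c where "c = 1 / (2 * (norm \<theta> + 1))"
  have c: "0 < c" "norm (c *\<^sub>R \<theta>) \<le> 1 / 2"
    using add_nonneg_pos[of "norm \<theta>" 1] by (simp_all add: c_def pos_divide_le_eq)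
  have "optimal_actions X \<theta> \<subseteq> optimal_actions_on X C"
    using \<theta>(1) by (auto simp: optimal_actions_on_def)
  then show thesis
    using \<theta>(2-4) u(1,3) c(2) that[of "c *\<^sub>R \<theta>" u z w] optimal_actions_scaleR[OF X(1) c(1), of \<theta>] by auto
qed

text \<open>With \<open>?w = transpose M *v u\<close>, the square of its norm is
  \<open>u \<bullet> (M *v ?w)\<close>, which is at most \<open>norm u * norm ?w\<close>; one factor
  cancels.\<close>

lemma norm_transpose_mult_le:
  fixes M :: "real^'m^'d"
  assumes "onorm ((*v) M) \<le> 1"
  shows "norm (transpose M *v u) \<le> norm u"
proof -
  let ?w = "transpose M *v u"
  have "norm ?w * norm ?w = u \<bullet> (M *v ?w)"
    by (simp add: dot_lmul_matrix[symmetric] transpose_matrix_vector power2_norm_eq_inner[symmetric] power2_eq_square[symmetric])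
  also have "\<dots> \<le> norm u * norm (M *v ?w)"
    by (rule norm_cauchy_schwarz)
  also have "norm (M *v ?w) \<le> onorm ((*v) M) * norm ?w"
    by (rule onorm) (rule matrix_vector_mul_bounded_linear)
  also have "\<dots> \<le> norm ?w"
    using mult_right_mono[OF assms norm_ge_zero, of ?w] by simp
  finally have "norm ?w * norm ?w \<le> norm u * norm ?w"
    by (simp add: mult_left_mono)
  then show ?thesis
    by (cases "norm ?w = 0") auto
qed

lemma bigomega_nat_I:
  fixes f g :: "nat \<Rightarrow> real"
  assumes "0 < c" "\<And>n. 1 \<le> n \<Longrightarrow> 0 \<le> g n" "\<And>n. 1 \<le> n \<Longrightarrow> c * g n \<le> f n"
  shows "f \<in> \<Omega>(g)"
proof (rule landau_omega.bigI[OF assms(1)])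
  show "\<forall>\<^sub>F n in sequentially. c * norm (g n) \<le> norm (f n)"
    using eventually_ge_at_top[of "1::nat"]
  proof eventually_elim
    case (elim n)
    then show ?case
      using assms(2,3)[of n] by simp
  qed
qed

section \<open>Lower bounds for the three rates\<close>

context
  fixes X :: "(real^'d) set" and A :: "real^'d \<Rightarrow> real^'m^'d"
  assumes X: "finite X" "X \<noteq> {}" "diameter X \<le> 1"
begin

lemma in_unit_ball:
  fixes \<theta> u :: "real^'d"
  assumes "norm \<theta> \<le> 1 / 2" "norm u = 1 / 2" "0 \<le> \<epsilon>" "\<epsilon> \<le> 1"
  shows "\<theta> \<in> cball 0 1" "\<theta> + \<epsilon> *\<^sub>R u \<in> cball 0 1" "\<theta> - \<epsilon> *\<^sub>R u \<in> cball 0 1"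
proof -
  have "norm (\<epsilon> *\<^sub>R u) \<le> 1 / 2"
    using assms mult_right_mono[of \<epsilon> 1 "norm u"] by simp
  then show "\<theta> \<in> cball 0 1" "\<theta> + \<epsilon> *\<^sub>R u \<in> cball 0 1" "\<theta> - \<epsilon> *\<^sub>R u \<in> cball 0 1"
    using assms(1) norm_triangle_ineq[of \<theta> "\<epsilon> *\<^sub>R u"] norm_triangle_ineq4[of \<theta> "\<epsilon> *\<^sub>R u"] by auto
qed

text \<open>At \<open>\<theta> = 0\<close> all actions are optimal, and \<open>u\<close> is
  invisible to all of them, so the two-point bound holds with \<open>\<kappa> = \<beta> = 0\<close>
  and a separation that does not shrink with \<open>n\<close>.\<close>

lemma minimax_regret_linear:
  assumes "\<not> globally_observable X A"
  shows "minimax_regret X A \<in> \<Omega>(\<lambda>n. real n)"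
proof -
  obtain x y where xy: "x \<in> X" "y \<in> X" "x - y \<notin> feedback_span A X"
    using assms by (auto simp: globally_observable_def)
  obtain u where u: "norm u = 1 / 2" "0 < (x - y) \<bullet> u" "\<And>z. z \<in> X \<Longrightarrow> transpose (A z) *v u = 0"
    using unobservable_direction[OF xy(3)] by blast
  have "real n * ((x - y) \<bullet> u) * (3 / 8 - real n * 0 / 4) / (2 + real n * ((x - y) \<bullet> u) * 0 / 4)
      \<le> minimax_regret X A n" for n
    using u xy in_unit_ball[of 0 u 1] by (intro minimax_regret_ge[where \<theta> = 0 and u = u and z = x and w = y] X)
      (auto simp: optimal_actions_0 X)
  then have "real n * (3 / 16 * ((x - y) \<bullet> u)) \<le> minimax_regret X A n" for n
    by (simp add: field_simps)
  then show ?thesis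
    using u(2) by (intro bigomega_nat_I[where c = "3 / 16 * ((x - y) \<bullet> u)"]) (auto simp: mult.commute)
qed

lemma minimax_regret_sqrt:
  assumes A: "\<And>x. x \<in> X \<Longrightarrow> onorm ((*v) (A x)) \<le> 1" and xy: "x \<in> X" "y \<in> X" "x \<noteq> y"
  shows "minimax_regret X A \<in> \<Omega>(\<lambda>n. real n powr (1 / 2))"
proof -
  define u where "u = (1 / (2 * norm (x - y))) *\<^sub>R (x - y)"
  have u: "norm u = 1 / 2" "0 < (x - y) \<bullet> u"
    using xy(3) by (auto simp: u_def)
  have "(x - y) \<bullet> u / 16 * real n powr (1 / 2) \<le> minimax_regret X A n" if "1 \<le> n" for n
  proof -
    \<comment> \<open>With \<open>\<beta> = \<epsilon>\<^sup>2\<close> this gives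
      \<open>real n * \<beta> = 1\<close>, so the numerator keeps the positive factor
      \<open>3 / 8 - 1 / 4\<close>, while \<open>real n * \<epsilon>\<close> is the desired
      rate.\<close>
    define \<epsilon> where "\<epsilon> = real n powr (- 1 / 2)"
    have \<epsilon>: "0 < \<epsilon>" "\<epsilon> \<le> 1"
      using that powr_mono[of "- 1 / 2" 0 "real n"] by (auto simp: \<epsilon>_def)
    have "\<epsilon>\<^sup>2 = real n powr (- 1)"
      by (simp add: \<epsilon>_def power2_eq_square flip: powr_add)
    then have n\<epsilon>: "real n * \<epsilon>\<^sup>2 = 1" "real n * \<epsilon> = real n powr (1 / 2)"
      using that by (simp_all add: \<epsilon>_def powr_mult_base)
    have "real n * (\<epsilon> * ((x - y) \<bullet> u)) * (3 / 8 - real n * \<epsilon>\<^sup>2 / 4) / (2 + real n * (\<epsilon> * ((x - y) \<bullet> u)) * 0 / 4)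
      \<le> minimax_regret X A n"
    proof (intro minimax_regret_ge[where \<theta> = 0 and u = "\<epsilon> *\<^sub>R u" and z = x and w = y] X)
      fix z assume "z \<in> X"
      then have "norm (transpose (A z) *v u) \<le> 1"
        using norm_transpose_mult_le[OF A, of z u] u by simp
      then have "\<epsilon>\<^sup>2 * (norm (transpose (A z) *v u))\<^sup>2 \<le> \<epsilon>\<^sup>2"
        by (simp add: mult_left_le power_le_one)
      then show "(norm (transpose (A z) *v \<epsilon> *\<^sub>R u))\<^sup>2 \<le> 0 * ((best_action X 0 - z) \<bullet> 0) + \<epsilon>\<^sup>2"
        by (simp add: matrix_vector_mult_scaleR power_mult_distrib)
    qed (use u xy \<epsilon> in_unit_ball[of 0 u \<epsilon>] in \<open>auto simp: optimal_actions_0 X\<close>)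
    also have "real n * (\<epsilon> * ((x - y) \<bullet> u)) * (3 / 8 - real n * \<epsilon>\<^sup>2 / 4) = real n powr (1 / 2) * ((x - y) \<bullet> u) / 8"
      unfolding n\<epsilon>(1) n\<epsilon>(2)[symmetric] by simp
    finally show ?thesis
      by (simp add: mult.commute)
  qed
  then show ?thesis
    using u(2) by (intro bigomega_nat_I[where c = "(x - y) \<bullet> u / 16"]) auto
qed

text \<open>The actions optimal at \<open>\<theta>\<close> reveal nothing about \<open>u\<close>, so
  information must be bought with regret: \<open>\<beta> = 0\<close>, and \<open>\<kappa>\<close>
  bounds the information per unit of gap.\<close>

lemma minimax_regret_two_thirds:
  assumes "\<not> locally_observable X A"
  shows "minimax_regret X A \<in> \<Omega>(\<lambda>n. real n powr (2 / 3))"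
proof -
  obtain \<theta> z w u where \<theta>: "norm \<theta> \<le> 1 / 2" "norm u = 1 / 2"
    "z \<in> optimal_actions X \<theta>" "w \<in> optimal_actions X \<theta>" "0 < (z - w) \<bullet> u"
    and perp: "\<And>x. x \<in> optimal_actions X \<theta> \<Longrightarrow> transpose (A x) *v u = 0"
    by (rule not_locally_observable_witness[OF X(1,2) assms]) blast
  let ?gap = "\<lambda>x. (best_action X \<theta> - x) \<bullet> \<theta>"
  have gap0: "0 \<le> ?gap x" if "x \<in> X" for x
    using instantaneous_regret_bounds(1)[OF X(1,3) _ that] \<theta>(1) by auto
  \<comment> \<open>Optimal actions contribute nothing to \<open>\<kappa>\<close>: both the numerator and the quotient by \<open>0\<close> vanish.\<close>
  define \<kappa> where "\<kappa> = (\<Sum>x\<in>X. (norm (transpose (A x) *v u))\<^sup>2 / ?gap x)"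
  have \<kappa>0: "0 \<le> \<kappa>"
    unfolding \<kappa>_def by (intro sum_nonneg divide_nonneg_nonneg gap0) auto
  have info: "(norm (transpose (A x) *v u))\<^sup>2 \<le> \<kappa> * ?gap x" if x: "x \<in> X" for x
  proof (cases "x \<in> optimal_actions X \<theta>")
    case True
    then show ?thesis using perp \<kappa>0 gap0[OF x] by simp
  next
    case False
    then have "?gap x \<noteq> 0"
      using x best_action_optimal[OF X(1,2), of \<theta>] by (auto simp: optimal_actions_def inner_diff_left)
    then have "0 < ?gap x"
      using gap0[OF x] by simp
    moreover have "(norm (transpose (A x) *v u))\<^sup>2 / ?gap x \<le> \<kappa>"
      unfolding \<kappa>_def using X(1) x gap0
      by (intro member_le_sum[of x X "\<lambda>x. (norm (transpose (A x) *v u))\<^sup>2 / ?gap x"]) auto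
    ultimately show ?thesis
      by (simp add: pos_divide_le_eq)
  qed
  let ?\<Delta> = "(z - w) \<bullet> u"
  define c where "c = 3 / 8 * ?\<Delta> / (2 + ?\<Delta> * \<kappa> / 4)"
  have c: "0 < c"
    unfolding c_def using \<theta>(5) \<kappa>0 by (intro divide_pos_pos add_pos_nonneg) auto
  have "c * real n powr (2 / 3) \<le> minimax_regret X A n" if "1 \<le> n" for n
  proof -
    \<comment> \<open>Scaling \<open>u\<close> by \<open>\<epsilon>\<close> scales the separation by
      \<open>\<epsilon>\<close> and \<open>\<kappa>\<close> by \<open>\<epsilon>\<^sup>2\<close>;
      this choice makes \<open>real n * (\<epsilon> * \<epsilon>\<^sup>2) = 1\<close>, so the
      denominator of the two-point bound is a constant.\<close>
    define \<epsilon> where "\<epsilon> = real n powr (- 1 / 3)"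
    have \<epsilon>: "0 < \<epsilon>" "\<epsilon> \<le> 1"
      using that powr_mono[of "- 1 / 3" 0 "real n"] by (auto simp: \<epsilon>_def)
    have "\<epsilon> * \<epsilon>\<^sup>2 = real n powr (- 1)"
      by (simp add: \<epsilon>_def power2_eq_square flip: powr_add)
    then have n\<epsilon>: "real n * (\<epsilon> * \<epsilon>\<^sup>2) = 1" "real n * \<epsilon> = real n powr (2 / 3)"
      using that by (simp_all add: \<epsilon>_def powr_mult_base)
    have "real n * (\<epsilon> * ?\<Delta>) * (3 / 8 - real n * 0 / 4) / (2 + real n * (\<epsilon> * ?\<Delta>) * (\<epsilon>\<^sup>2 * \<kappa>) / 4)
      \<le> minimax_regret X A n"
    proof (intro minimax_regret_ge[where \<theta> = \<theta> and u = "\<epsilon> *\<^sub>R u" and z = z and w = w] X)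
      fix x assume "x \<in> X"
      from mult_left_mono[OF info[OF this], of "\<epsilon>\<^sup>2"]
      show "(norm (transpose (A x) *v \<epsilon> *\<^sub>R u))\<^sup>2 \<le> \<epsilon>\<^sup>2 * \<kappa> * ?gap x + 0"
        by (simp add: matrix_vector_mult_scaleR power_mult_distrib mult.assoc)
    qed (use \<theta> \<epsilon> \<kappa>0 in_unit_ball[of \<theta> u \<epsilon>] in auto)
    also have "real n * (\<epsilon> * ?\<Delta>) * (\<epsilon>\<^sup>2 * \<kappa>) = ?\<Delta> * \<kappa>"
      using arg_cong[OF n\<epsilon>(1), of "\<lambda>r. r * (?\<Delta> * \<kappa>)"] by (simp add: ac_simps)
    also have "real n * (\<epsilon> * ?\<Delta>) * (3 / 8 - real n * 0 / 4) = 3 / 8 * ?\<Delta> * real n powr (2 / 3)"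
      using n\<epsilon>(2)[symmetric] by (simp add: ac_simps)
    finally show ?thesis
      by (simp add: c_def)
  qed
  then show ?thesis
    using c by (intro bigomega_nat_I[where c = c]) auto
qed

end

section \<open>Games with a single Pareto optimal action\<close>

lemma minimax_regret_singleton:
  fixes A :: "real^'d \<Rightarrow> real^'m^'d"
  shows "minimax_regret {x} A n = 0"
proof -
  have "expected_regret {x} A \<pi> \<theta> n = 0" if \<pi>: "\<pi> \<in> policies {x}" for \<pi> \<theta>
  proof -
    have best: "best_action {x} \<theta> = x"
      using best_action_optimal[of "{x}" \<theta>] by (auto simp: optimal_actions_def)
    have "regret {x} \<theta> n h = 0" if "h \<in> space (history_law {x} A \<pi> \<theta> n)" for h
      using that unfolding regret_def best space_history_law[OF \<pi>]
      by (intro sum.neutral) (auto simp: space_PiM PiE_iff space_pair_measure mem_Times_iff)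
    then have "expected_regret {x} A \<pi> \<theta> n = (\<integral>h. 0 \<partial>history_law {x} A \<pi> \<theta> n)"
      unfolding expected_regret_def by (intro Bochner_Integration.integral_cong) auto
    then show ?thesis by simp
  qed
  then have "(SUP \<theta>\<in>cball 0 1. expected_regret {x} A \<pi> \<theta> n) = 0" if "\<pi> \<in> policies {x}" for \<pi>
    using that by (simp del: cball_eq_empty) (subst cSUP_const, simp_all)
  then have "minimax_regret {x} A n = (INF \<pi>\<in>(policies {x} :: (nat \<Rightarrow> (nat \<Rightarrow> (real^'d) \<times> (real^'m)) \<Rightarrow> (real^'d) measure) set). 0)"
    unfolding minimax_regret_def by (intro INF_cong) auto
  also have "\<dots> = 0"
    by (intro cINF_const policies_nonempty) simp
  finally show ?thesis .
qed

text \<open>By Krein-Milman the convex hull is generated by its extreme points, all of which lie in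
  \<open>X\<close>; a single one forces the hull, and with it \<open>X\<close>, to be a
  point.\<close>

lemma pareto_optimal_unique_iff:
  assumes "finite X" "X \<noteq> {}"
  shows "(\<exists>!x. pareto_optimal X x) \<longleftrightarrow> (\<exists>x. X = {x})"
proof
  assume "\<exists>!x. pareto_optimal X x"
  then obtain x where x: "\<And>y. pareto_optimal X y \<longleftrightarrow> y = x"
    by auto
  have "{y. y extreme_point_of (convex hull X)} = {x}"
    using x extreme_point_of_convex_hull[of _ X] by (auto simp: pareto_optimal_def)
  then have "convex hull X = {x}"
    using Krein_Milman_Minkowski[of "convex hull X"] assms
    by (simp add: compact_convex_hull finite_imp_compact)
  then show "\<exists>x. X = {x}"
    using hull_subset[of X convex] assms(2) by (intro exI[of _ x]) auto
next
  assume "\<exists>x. X = {x}"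
  then show "\<exists>!x. pareto_optimal X x"
    by (auto simp: pareto_optimal_def extreme_point_of_singleton)
qed

section \<open>Phased elimination\<close>

text \<open>An element of the span of the columns is a sum of products \<open>A z *v c z\<close>.
  Coefficients are chosen once for each of the finitely many triples \<open>S\<close>,
  \<open>x\<close>, \<open>y\<close>, so one constant \<open>W\<close> bounds them all. Their
  vanishing outside \<open>S\<close> means that only observations of actions in \<open>S\<close> are
  used.\<close>

lemma bounded_weights_exist:
  fixes X :: "(real^'d) set" and A :: "real^'d \<Rightarrow> real^'m^'d"
  assumes "finite X"
  obtains w :: "(real^'d) set \<Rightarrow> real^'d \<Rightarrow> real^'d \<Rightarrow> real^'d \<Rightarrow> real^'m" and W :: real
  where "0 < W" "\<And>S x y z. norm (w S x y z) \<le> W" "\<And>S x y z. z \<notin> S \<Longrightarrow> w S x y z = 0"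
    "\<And>S x y. S \<subseteq> X \<Longrightarrow> x \<in> S \<Longrightarrow> y \<in> S \<Longrightarrow> x - y \<in> feedback_span A S \<Longrightarrow>
      x - y = (\<Sum>z\<in>X. A z *v w S x y z)"
proof -
  have ex: "\<exists>c. v = (\<Sum>z\<in>S. A z *v c z)" if "finite S" "v \<in> feedback_span A S" for v S
  proof -
    let ?V = "range (\<lambda>c. \<Sum>z\<in>S. A z *v c z)"
    have "subspace ?V"
    proof (rule subspaceI)
      show "0 \<in> ?V"
        by (rule image_eqI[of _ _ "\<lambda>_. 0"]) auto
      show "a + b \<in> ?V" if ab: "a \<in> ?V" "b \<in> ?V" for a b
      proof -
        obtain c d where "a = (\<Sum>z\<in>S. A z *v c z)" "b = (\<Sum>z\<in>S. A z *v d z)"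
          using ab by auto
        then show ?thesis
          by (intro image_eqI[of _ _ "\<lambda>z. c z + d z"]) (auto simp: matrix_vector_right_distrib sum.distrib)
      qed
      show "r *\<^sub>R a \<in> ?V" if a: "a \<in> ?V" for r a
      proof -
        obtain c where "a = (\<Sum>z\<in>S. A z *v c z)"
          using a by auto
        then show ?thesis
          by (intro image_eqI[of _ _ "\<lambda>z. r *\<^sub>R c z"]) (auto simp: matrix_vector_mult_scaleR scaleR_sum_right)
      qed
    qed
    moreover have "(\<Union>z\<in>S. columns (A z)) \<subseteq> ?V"
    proof
      fix v assume "v \<in> (\<Union>z\<in>S. columns (A z))"
      then obtain z i where z: "z \<in> S" "v = column i (A z)"
        by (auto simp: columns_def)
      have "(\<Sum>z'\<in>S. A z' *v (if z' = z then axis i 1 else 0)) = (\<Sum>z'\<in>S. if z' = z then A z *v axis i 1 else 0)"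
        by (intro sum.cong) auto
      also have "\<dots> = v"
        using z that(1) by (simp add: matrix_vector_mult_basis)
      finally show "v \<in> ?V"
        by (intro image_eqI[of _ _ "\<lambda>z'. if z' = z then axis i 1 else 0"]) auto
    qed
    ultimately have "feedback_span A S \<subseteq> ?V"
      unfolding feedback_span_def by (intro span_minimal)
    with that(2) show ?thesis by auto
  qed
  define c where "c S v = (SOME c. v = (\<Sum>z\<in>S. A z *v c z))" for S v
  have c: "v = (\<Sum>z\<in>S. A z *v c S v z)" if "finite S" "v \<in> feedback_span A S" for S v
    unfolding c_def using ex[OF that] by (rule someI_ex)
  \<comment> \<open>Outside the relevant arguments the weight is \<open>0\<close>, which makes the
    bound hold without side conditions and leaves only finitely many norms to compare.\<close>
  define w where "w S x y z = (if S \<subseteq> X \<and> x \<in> S \<and> y \<in> S \<and> z \<in> S then c S (x - y) z else 0)" for S x y z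
  define B where "B = (\<lambda>(S, x, y, z). norm (w S x y z)) ` (Pow X \<times> X \<times> X \<times> X)"
  have fin: "finite B"
    unfolding B_def using assms by simp
  \<comment> \<open>The inserted \<open>1\<close> makes the bound positive even if all weights
    vanish.\<close>
  have "norm (w S x y z) \<le> Max (insert 1 B)" for S x y z
  proof (cases "S \<subseteq> X \<and> x \<in> S \<and> y \<in> S \<and> z \<in> S")
    case True
    then have "norm (w S x y z) \<in> B"
      unfolding B_def by (intro image_eqI[of _ _ "(S, x, y, z)"]) auto
    then show ?thesis
      using fin by (intro Max_ge) auto
  next
    case False
    have "0 \<le> Max (insert 1 B)"
      using fin Max_ge[of "insert 1 B" 1] by (intro order_trans[OF zero_le_one]) simp
    with False show ?thesis
      by (auto simp: w_def)
  qed
  moreover have "0 < Max (insert 1 B)"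
    using fin Max_ge[of "insert 1 B" 1] by (intro less_le_trans[OF zero_less_one]) simp
  moreover have "x - y = (\<Sum>z\<in>X. A z *v w S x y z)"
    if "S \<subseteq> X" "x \<in> S" "y \<in> S" "x - y \<in> feedback_span A S" for S x y
  proof -
    have "(\<Sum>z\<in>X. A z *v w S x y z) = (\<Sum>z\<in>S. A z *v w S x y z)"
      using assms that(1) by (intro sum.mono_neutral_right) (auto simp: w_def)
    also have "\<dots> = (\<Sum>z\<in>S. A z *v c S (x - y) z)"
      using that by (intro sum.cong) (auto simp: w_def)
    finally show ?thesis
      using c[OF finite_subset[OF that(1) assms] that(4)] by simp
  qed
  ultimately show thesis
    by (intro that[of "Max (insert 1 B)" w]) (auto simp: w_def)
qed

lemma optimal_actions_on_subset: "optimal_actions_on X C \<subseteq> X"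
  by (auto simp: optimal_actions_on_def optimal_actions_def)

lemma sum_mod_cycles:
  fixes f :: "nat \<Rightarrow> 'a::real_vector"
  shows "(\<Sum>t\<in>{N * a..<N * (a + k)}. f (t mod N)) = real k *\<^sub>R (\<Sum>j<N. f j)"
proof (induction k)
  case (Suc k)
  have "(\<Sum>t\<in>{N * a..<N * (a + Suc k)}. f (t mod N)) =
      (\<Sum>t\<in>{N * a..<N * (a + k)}. f (t mod N)) + (\<Sum>t\<in>{N * (a + k)..<N * (a + k) + N}. f (t mod N))"
    by (subst sum.atLeastLessThan_concat) (auto simp: algebra_simps)
  also have "(\<Sum>t\<in>{N * (a + k)..<N * (a + k) + N}. f (t mod N)) = (\<Sum>j\<in>{0..<N}. f j)"
    using sum.shift_bounds_nat_ivl[of "\<lambda>t. f (t mod N)" 0 "N * (a + k)" N]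
    by (simp add: add.commute)
  finally show ?case
    using Suc by (simp add: scaleR_left_distrib atLeast0LessThan)
qed simp

lemma measurable_count_space_range:
  "f \<in> M \<rightarrow>\<^sub>M count_space UNIV \<Longrightarrow> f \<in> M \<rightarrow>\<^sub>M count_space (range f)"
  by (auto simp: measurable_def)

text \<open>\<open>m k\<close> is the number of sweeps in phase \<open>k\<close>,
  \<open>\<eta> k\<close> its accuracy, and \<open>w S x y\<close> the weights with which
  observations of actions in \<open>S\<close> estimate the reward difference of \<open>x\<close> and
  \<open>y\<close>. That the weights represent \<open>x - y\<close> is assumed only later, phase by
  phase, so the policy is defined for every game.\<close>

locale phased_elimination =
  fixes X :: "(real^'d) set" and A :: "real^'d \<Rightarrow> real^'m^'d"
    and e :: "nat \<Rightarrow> real^'d" and m :: "nat \<Rightarrow> nat" and \<eta> :: "nat \<Rightarrow> real"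
    and w :: "(real^'d) set \<Rightarrow> real^'d \<Rightarrow> real^'d \<Rightarrow> real^'d \<Rightarrow> real^'m" and W :: real
  assumes X: "finite X" "X \<noteq> {}" "diameter X \<le> 1"
    and e: "bij_betw e {..<card X} X"
    and m_pos: "\<And>k. 0 < m k" and \<eta>_pos: "\<And>k. 0 < \<eta> k"
    and W: "0 < W" "\<And>S x y z. norm (w S x y z) \<le> W"
    and w_outside: "\<And>S x y z. z \<notin> S \<Longrightarrow> w S x y z = 0"
begin

text \<open>Phase \<open>k\<close> consists of \<open>m k\<close> sweeps over the enumeration \<open>e\<close> of all actions; the turn of an action
  that is no longer plausible is given to a plausible one.\<close>

definition start :: "nat \<Rightarrow> nat" where
  "start k = card X * (\<Sum>j<k. m j)"

definition rounds :: "nat \<Rightarrow> nat set" where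
  "rounds k = {start k..<start (Suc k)}"

definition phase :: "nat \<Rightarrow> nat" where
  "phase t = (LEAST k. t < start (Suc k))"

definition arm :: "nat \<Rightarrow> real^'d" where
  "arm t = e (t mod card X)"

lemma card_X_pos: "0 < card X"
  using X by (simp add: card_gt_0_iff)

lemma arm_in_X: "arm t \<in> X"
  using bij_betwE[OF e] card_X_pos by (simp add: arm_def)

lemma start_0 [simp]: "start 0 = 0"
  by (simp add: start_def)

lemma start_Suc: "start (Suc k) = start k + card X * m k"
  by (simp add: start_def distrib_left)

lemma mono_start: "mono start"
  by (intro mono_iff_le_Suc[THEN iffD2]) (simp add: start_Suc)

text \<open>Each phase lasts at least one round, so every round is eventually covered and the least
  index in \<open>phase\<close> exists.\<close>

lemma le_start: "k \<le> start k"
proof (induction k)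
  case (Suc k)
  have "1 \<le> card X * m k"
    using card_X_pos m_pos[of k] by (simp add: Suc_leI)
  with Suc show ?case unfolding start_Suc by linarith
qed simp

lemma phase_round: "t \<in> rounds (phase t)"
proof -
  have "t < start (Suc t)"
    using le_start[of "Suc t"] by simp
  then have "t < start (Suc (phase t))"
    unfolding phase_def by (rule LeastI)
  moreover have "start (phase t) \<le> t"
  proof (cases "phase t")
    case (Suc j)
    then have "\<not> t < start (Suc j)"
      unfolding phase_def using not_less_Least[of j "\<lambda>k. t < start (Suc k)"] by (simp add: phase_def)
    then show ?thesis by (simp add: Suc)
  qed simp
  ultimately show ?thesis by (simp add: rounds_def)
qed

lemma phase_eqI:
  assumes "t \<in> rounds k"
  shows "phase t = k"
proof (rule antisym)
  show "phase t \<le> k"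
    unfolding phase_def using assms by (intro Least_le) (simp add: rounds_def)
  show "k \<le> phase t"
  proof (rule ccontr)
    assume "\<not> k \<le> phase t"
    then have "start (Suc (phase t)) \<le> start k"
      by (intro monoD[OF mono_start]) simp
    then show False
      using phase_round[of t] assms by (auto simp: rounds_def)
  qed
qed

lemma finite_rounds [simp]: "finite (rounds k)"
  by (simp add: rounds_def)

lemma card_rounds: "card (rounds k) = card X * m k"
  by (simp add: rounds_def start_Suc)

text \<open>A phase consists of complete sweeps, so in it every action has exactly
  \<open>m k\<close> turns.\<close>

lemma sum_rounds_arm:
  fixes f :: "real^'d \<Rightarrow> 'b::real_vector"
  shows "(\<Sum>t\<in>rounds k. f (arm t)) = real (m k) *\<^sub>R (\<Sum>z\<in>X. f z)"
proof -
  have "(\<Sum>t\<in>rounds k. f (arm t)) = real (m k) *\<^sub>R (\<Sum>j<card X. f (e j))"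
    using sum_mod_cycles[of "\<lambda>j. f (e j)" "card X" "\<Sum>j<k. m j" "m k"]
    by (simp add: rounds_def start_def arm_def)
  also have "(\<Sum>j<card X. f (e j)) = (\<Sum>z\<in>X. f z)"
    by (rule sum.reindex_bij_betw[OF e])
  finally show ?thesis .
qed

text \<open>If the weights represent \<open>x - y\<close>, the mean of this statistic is
  \<open>(x - y) \<bullet> \<theta>\<close>. The weight belongs to the turn \<open>arm t\<close> and
  not to the action played, so that a turn reassigned because \<open>arm t\<close> lies outside
  \<open>S\<close> carries weight \<open>0\<close>.\<close>

definition estimate :: "nat \<Rightarrow> (real^'d) set \<Rightarrow> real^'d \<Rightarrow> real^'d \<Rightarrow> (nat \<Rightarrow> (real^'d) \<times> (real^'m)) \<Rightarrow> real" where
  "estimate k S x y h = (\<Sum>t\<in>rounds k. w S x y (arm t) \<bullet> snd (h t)) / real (m k)"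

text \<open>
  Rounding the estimates to the grid \<open>\<eta> k * \<int>\<close> leaves only countably many possible confidence
  sets, which makes every function of them measurable.
\<close>

definition refine :: "nat \<Rightarrow> (real^'d) set \<Rightarrow> (real^'d \<Rightarrow> real^'d \<Rightarrow> int) \<Rightarrow> (real^'d) set" where
  "refine k C r = {\<theta>\<in>C. \<forall>x\<in>optimal_actions_on X C. \<forall>y\<in>optimal_actions_on X C.
     \<bar>(x - y) \<bullet> \<theta> - \<eta> k * of_int (r x y)\<bar> \<le> 2 * \<eta> k}"

primrec confidence :: "nat \<Rightarrow> (nat \<Rightarrow> (real^'d) \<times> (real^'m)) \<Rightarrow> (real^'d) set" where
  "confidence 0 h = UNIV"
| "confidence (Suc k) h = refine k (confidence k h)
     (\<lambda>x y. \<lfloor>estimate k (optimal_actions_on X (confidence k h)) x y h / \<eta> k\<rfloor>)"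

abbreviation plausible :: "nat \<Rightarrow> (nat \<Rightarrow> (real^'d) \<times> (real^'m)) \<Rightarrow> (real^'d) set" where
  "plausible k h \<equiv> optimal_actions_on X (confidence k h)"

text \<open>An empty plausible set comes only from an empty confidence set, since every parameter
  has an optimal action; the default then keeps the action inside \<open>X\<close>.\<close>

definition pick :: "nat \<Rightarrow> (real^'d) set \<Rightarrow> real^'d" where
  "pick t S = (if arm t \<in> S \<or> S = {} then arm t else (SOME x. x \<in> S))"

definition action :: "nat \<Rightarrow> (nat \<Rightarrow> (real^'d) \<times> (real^'m)) \<Rightarrow> real^'d" where
  "action t h = pick t (plausible (phase t) h)"

definition policy :: "nat \<Rightarrow> (nat \<Rightarrow> (real^'d) \<times> (real^'m)) \<Rightarrow> (real^'d) measure" where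
  "policy t h = return (count_space X) (action t h)"

lemma pick_in: "S \<noteq> {} \<Longrightarrow> pick t S \<in> S"
  by (auto simp: pick_def some_in_eq)

lemma action_in_X: "action t h \<in> X"
proof (cases "plausible (phase t) h = {}")
  case True
  then show ?thesis by (simp add: action_def pick_def arm_in_X)
next
  case False
  then show ?thesis
    using pick_in[OF False, of t] optimal_actions_on_subset[of X] by (auto simp: action_def)
qed

text \<open>Each refinement intersects with slabs, the preimages of intervals under linear
  functionals. Convexity is what lets local observability be applied in every phase.\<close>

lemma convex_confidence: "convex (confidence k h)"
proof (induction k)
  case (Suc k)
  have eq: "confidence (Suc k) h = confidence k h \<inter>
      (\<Inter>x\<in>plausible k h. \<Inter>y\<in>plausible k h. {\<theta>. (x - y) \<bullet> \<theta> \<in>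
        cball (\<eta> k * of_int \<lfloor>estimate k (plausible k h) x y h / \<eta> k\<rfloor>) (2 * \<eta> k)})"
    by (auto simp: refine_def dist_real_def abs_minus_commute)
  have "convex {\<theta>. v \<bullet> \<theta> \<in> cball a r}" for v :: "real^'d" and a r :: real
    using convex_linear_vimage[OF bounded_linear.linear[OF bounded_linear_inner_right[of v]] convex_cball, of a r]
    by (simp add: vimage_def)
  then show ?case
    unfolding eq by (intro convex_Int Suc convex_INT)
qed simp

lemma estimate_upd: "start (Suc k) \<le> t \<Longrightarrow> estimate k S x y (h(t := z)) = estimate k S x y h"
  unfolding estimate_def by (intro arg_cong[where f = "\<lambda>s. s / _"] sum.cong) (auto simp: rounds_def)

text \<open>Only rounds before phase \<open>k\<close> enter. This makes \<open>action\<close>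
  nonanticipating, and the estimator weights predictable as the exponential martingale
  demands.\<close>

lemma confidence_upd: "start k \<le> t \<Longrightarrow> confidence k (h(t := z)) = confidence k h"
proof (induction k)
  case (Suc k)
  then have "start k \<le> t"
    by (simp add: start_Suc)
  then show ?case
    by (simp only: confidence.simps Suc.IH estimate_upd[OF Suc.prems])
qed simp

lemma start_phase_le: "start (phase t) \<le> t"
  using phase_round[of t] by (simp add: rounds_def)

lemma action_upd: "t \<le> s \<Longrightarrow> action t (h(s := z)) = action t h"
  using start_phase_le[of t] by (simp add: action_def confidence_upd)

lemma confidence_mono: "confidence (Suc k) h \<subseteq> confidence k h"
  by (auto simp: refine_def)

lemma plausible_mono: "plausible (Suc k) h \<subseteq> plausible k h"
  unfolding optimal_actions_on_def using confidence_mono by (intro UN_mono) auto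

section \<open>Measurability of the policy\<close>

lemma countable_range_confidence: "countable (range (confidence k))"
proof (induction k)
  case (Suc k)
  let ?R = "PiE (X \<times> X) (\<lambda>_. UNIV :: int set)"
  let ?F = "\<lambda>(C, r). refine k C (\<lambda>x y. r (x, y))"
  have "confidence (Suc k) h \<in> ?F ` (range (confidence k) \<times> ?R)" for h
  proof (rule image_eqI)
    \<comment> \<open>Restriction to \<open>X \<times> X\<close> loses nothing, as plausible actions
      lie in \<open>X\<close>, and leaves countably many integer tables.\<close>
    let ?r = "restrict (\<lambda>(x, y). \<lfloor>estimate k (plausible k h) x y h / \<eta> k\<rfloor>) (X \<times> X)"
    show "confidence (Suc k) h = ?F (confidence k h, ?r)"
      using optimal_actions_on_subset[of X "confidence k h"] by (auto simp: refine_def subset_iff)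
  qed auto
  then have "range (confidence (Suc k)) \<subseteq> ?F ` (range (confidence k) \<times> ?R)"
    by auto
  moreover have "countable ?R"
    using X by (intro countable_PiE) auto
  ultimately show ?case
    using Suc by (meson countable_SIGMA countable_image countable_subset)
qed simp

lemma measurable_estimate:
  "start (Suc k) \<le> n \<Longrightarrow> estimate k S x y \<in> borel_measurable (history_space X n)"
  unfolding estimate_def[abs_def]
  by (intro borel_measurable_divide borel_measurable_sum borel_measurable_inner borel_measurable_const
      measurable_observation) (auto simp: rounds_def)

text \<open>For a fixed set \<open>C\<close> the table of rounded estimates is a measurable map into
  a countable space; the dependence on the random set is then handled by splitting over its
  countably many values.\<close>

lemma measurable_confidence:
  "start k \<le> n \<Longrightarrow> confidence k \<in> history_space X n \<rightarrow>\<^sub>M count_space (range (confidence k))"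
proof (induction k)
  case (Suc k)
  let ?M = "history_space X n" and ?R = "PiE (X \<times> X) (\<lambda>_. UNIV :: int set)"
  have IH: "confidence k \<in> ?M \<rightarrow>\<^sub>M count_space (range (confidence k))"
    using Suc by (simp add: start_Suc)
  let ?r = "\<lambda>C h. restrict (\<lambda>(x, y). \<lfloor>estimate k (optimal_actions_on X C) x y h / \<eta> k\<rfloor>) (X \<times> X)"
  have r: "?r C \<in> ?M \<rightarrow>\<^sub>M count_space ?R" for C
  proof -
    have "?r C -` {a} \<inter> space ?M \<in> sets ?M" if "a \<in> ?R" for a
    proof -
      have "?r C -` {a} \<inter> space ?M =
          {h\<in>space ?M. \<forall>p\<in>X \<times> X. \<lfloor>estimate k (optimal_actions_on X C) (fst p) (snd p) h / \<eta> k\<rfloor> = a p}"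
        using that by (auto simp: fun_eq_iff PiE_iff extensional_def restrict_def)
      also have "\<dots> \<in> sets ?M"
      proof (intro sets.sets_Collect_finite_All')
        fix p assume "p \<in> X \<times> X"
        have "(\<lambda>h. \<lfloor>estimate k (optimal_actions_on X C) (fst p) (snd p) h / \<eta> k\<rfloor>) \<in> ?M \<rightarrow>\<^sub>M count_space UNIV"
          by (intro measurable_compose[OF _ measurable_real_floor] borel_measurable_divide
              measurable_estimate Suc.prems borel_measurable_const)
        from measurable_sets[OF this, of "{a p}"]
        show "{h\<in>space ?M. \<lfloor>estimate k (optimal_actions_on X C) (fst p) (snd p) h / \<eta> k\<rfloor> = a p} \<in> sets ?M"
          by (simp add: vimage_def Int_def conj_commute)
      qed (use X in auto)
      finally show ?thesis .
    qed
    moreover have "countable ?R"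
      using X by (intro countable_PiE) auto
    ultimately show ?thesis
      by (subst measurable_count_space_eq_countable) auto
  qed
  have "(\<lambda>h. refine k (confidence k h) (\<lambda>x y. ?r (confidence k h) h (x, y))) \<in> ?M \<rightarrow>\<^sub>M count_space UNIV"
    by (rule measurable_compose_countable'[OF _ IH countable_range_confidence],
        rule measurable_compose[OF r]) simp
  moreover have "(\<lambda>h. refine k (confidence k h) (\<lambda>x y. ?r (confidence k h) h (x, y))) = confidence (Suc k)"
    using optimal_actions_on_subset[of X] by (auto simp: refine_def subset_iff fun_eq_iff)
  ultimately have "confidence (Suc k) \<in> ?M \<rightarrow>\<^sub>M count_space UNIV"
    by simp
  then show ?case
    by (rule measurable_count_space_range)
next
  case 0
  have "confidence 0 = (\<lambda>_. UNIV)"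
    by auto
  then show ?case
    by simp
qed

lemma measurable_plausible_function:
  assumes "start k \<le> n" "\<And>S. g S \<in> space N"
  shows "(\<lambda>h. g (plausible k h)) \<in> history_space X n \<rightarrow>\<^sub>M N"
  by (rule measurable_compose[OF measurable_confidence[OF assms(1)]]) (use assms(2) in auto)

lemma measurable_action_rule: "t \<le> n \<Longrightarrow> action t \<in> history_space X n \<rightarrow>\<^sub>M count_space X"
  unfolding measurable_def
  using measurable_plausible_function[of "phase t" n "pick t" "count_space UNIV"] start_phase_le[of t] action_in_X[of t]
  by (auto simp: measurable_def action_def[abs_def])

lemma policy: "policy \<in> policies X"
  unfolding policies_def policy_def[abs_def]
  by (auto intro: measurable_compose[OF measurable_action_rule measurable_return_prob_space])

text \<open>The number of rounds that depart from the rule has integral \<open>0\<close>, by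
  induction: the last round draws from the point mass at \<open>action n h\<close>, and overwriting
  round \<open>n\<close> changes neither the earlier departures nor \<open>action n\<close>.\<close>

lemma AE_follows_policy:
  "AE h in history_law X A policy \<theta> n. \<forall>t<n. fst (h t) = action t h"
proof -
  let ?f = "\<lambda>t h. if fst (h t) = action t h then 0 else 1 :: ennreal"
  have meas: "?f t \<in> borel_measurable (history_space X n)" if "t < n" for t n
  proof (rule measurable_If)
    have "{h\<in>space (history_space X n). fst (h t) = action t h} =
        (\<Union>x\<in>X. ((\<lambda>h. fst (h t)) -` {x} \<inter> space (history_space X n)) \<inter> (action t -` {x} \<inter> space (history_space X n)))"
      using action_in_X[of t] by auto
    also have "\<dots> \<in> sets (history_space X n)"
      using that X
      by (intro sets.finite_UN sets.Int measurable_sets[OF measurable_action] measurable_sets[OF measurable_action_rule]) auto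
    finally show "{h\<in>space (history_space X n). fst (h t) = action t h} \<in> sets (history_space X n)" .
  qed auto
  have sum_meas: "(\<lambda>h. \<Sum>t<n. ?f t h) \<in> borel_measurable (history_space X n)" for n
    using meas by (intro borel_measurable_sum) auto
  have "(\<integral>\<^sup>+h. (\<Sum>t<n. ?f t h) \<partial>history_law X A policy \<theta> n) = 0" for n
  proof (induction n)
    case (Suc n)
    have "(\<integral>\<^sup>+h. (\<Sum>t<Suc n. ?f t h) \<partial>history_law X A policy \<theta> (Suc n)) =
      (\<integral>\<^sup>+h. \<integral>\<^sup>+x. \<integral>\<^sup>+e. (\<Sum>t<Suc n. ?f t (h(n := (x, transpose (A x) *v \<theta> + e)))) \<partial>gaussian_noise \<partial>policy n h
        \<partial>history_law X A policy \<theta> n)"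
      by (rule nn_integral_history_law_Suc(1)[OF policy sum_meas])
    also have "\<dots> = (\<integral>\<^sup>+h. (\<Sum>t<n. ?f t h) \<partial>history_law X A policy \<theta> n)"
    proof (intro nn_integral_cong)
      fix h assume "h \<in> space (history_law X A policy \<theta> n)"
      have upd: "(\<Sum>t<n. ?f t (h(n := z))) = (\<Sum>t<n. ?f t h)" for z
        by (intro sum.cong) (auto simp: action_upd)
      have "(\<integral>\<^sup>+x. \<integral>\<^sup>+e. (\<Sum>t<Suc n. ?f t (h(n := (x, transpose (A x) *v \<theta> + e)))) \<partial>gaussian_noise \<partial>policy n h)
         = (\<integral>\<^sup>+x. (\<Sum>t<n. ?f t h) + (if x = action n h then 0 else 1) \<partial>policy n h)"
        by (simp add: upd action_upd prob_space.emeasure_space_1[OF prob_space_gaussian_noise])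
      also have "\<dots> = (\<Sum>t<n. ?f t h)"
        unfolding policy_def by (subst nn_integral_return) (auto simp: action_in_X)
      finally show "(\<integral>\<^sup>+x. \<integral>\<^sup>+e. (\<Sum>t<Suc n. ?f t (h(n := (x, transpose (A x) *v \<theta> + e)))) \<partial>gaussian_noise \<partial>policy n h)
         = (\<Sum>t<n. ?f t h)" .
    qed
    finally show ?case using Suc by simp
  qed simp
  then have "AE h in history_law X A policy \<theta> n. (\<Sum>t<n. ?f t h) = 0"
    by (subst nn_integral_0_iff_AE[symmetric])
       (simp_all only: measurable_cong_sets[OF sets_history_law[OF policy] refl] sum_meas)
  then show ?thesis
    by eventually_elim (auto split: if_splits)
qed

end

section \<open>Concentration of the estimates and regret of the policy\<close>

context phased_elimination
begin

text \<open>Noise part of \<open>m k\<close> times the estimate. The sum stops at the horizon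
  \<open>n\<close>, which makes it a function of the first \<open>n\<close> rounds even when phase
  \<open>k\<close> is cut short or not reached.\<close>

definition deviation :: "real^'d \<Rightarrow> nat \<Rightarrow> nat \<Rightarrow> real^'d \<Rightarrow> real^'d \<Rightarrow> (nat \<Rightarrow> (real^'d) \<times> (real^'m)) \<Rightarrow> real" where
  "deviation \<theta> n k x y h =
     (\<Sum>t<n. if t \<in> rounds k then w (plausible k h) x y (arm t) \<bullet> noise A \<theta> (h t) else 0)"

lemma start_rounds_le: "t \<in> rounds k \<Longrightarrow> start k \<le> t"
  by (simp add: rounds_def)

lemma measurable_weight:
  assumes "start k \<le> n"
  shows "(\<lambda>h. w (plausible k h) x y z) \<in> borel_measurable (history_space X n)"
  using assms by (intro measurable_plausible_function[where g = "\<lambda>S. w S x y z"]) auto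

lemma measurable_deviation: "deviation \<theta> n k x y \<in> borel_measurable (history_space X n)"
  unfolding deviation_def[abs_def]
proof (intro borel_measurable_sum)
  fix t assume "t \<in> {..<n}"
  then show "(\<lambda>h. if t \<in> rounds k then w (plausible k h) x y (arm t) \<bullet> noise A \<theta> (h t) else 0)
      \<in> borel_measurable (history_space X n)"
    using start_rounds_le[of t k]
    by (cases "t \<in> rounds k") (auto intro!: borel_measurable_inner measurable_weight measurable_noise)
qed

text \<open>The vectors \<open>r *\<^sub>R w (plausible k h) x y (arm t)\<close> are fixed before
  phase \<open>k\<close> starts, so they are predictable and the exponential martingale applies; its
  quadratic term is at most half of \<open>r\<^sup>2 * W\<^sup>2\<close> times the number of rounds
  of the phase.\<close>

lemma nn_integral_exp_deviation:
  "(\<integral>\<^sup>+h. ennreal (exp (r * deviation \<theta> n k x y h)) \<partial>history_law X A policy \<theta> n) \<le>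
     ennreal (exp (r\<^sup>2 * W\<^sup>2 * real (card X * m k) / 2))"
proof -
  let ?P = "history_law X A policy \<theta> n"
  let ?v = "\<lambda>t h. if t \<in> rounds k then r *\<^sub>R w (plausible k h) x y (arm t) else 0"
  let ?L = "\<lambda>h. \<Sum>t<n. ?v t h \<bullet> noise A \<theta> (h t) - (norm (?v t h))\<^sup>2 / 2"
  let ?c = "r\<^sup>2 * W\<^sup>2 * real (card X * m k) / 2"
  have v: "?v t \<in> borel_measurable (history_space X n)" if "t < n" for t n
    using that start_rounds_le[of t k]
    by (cases "t \<in> rounds k") (auto intro!: borel_measurable_scaleR measurable_weight)
  have upd: "?v t (h(n := z)) = ?v t h" if "t \<le> n" for t n h z
    using that start_rounds_le[of t k] by (auto simp: confidence_upd)
  have L: "(\<lambda>h. ennreal (exp (?L h))) \<in> borel_measurable ?P"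
    unfolding measurable_cong_sets[OF sets_history_law[OF policy] refl]
    by (intro measurable_compose[OF _ measurable_ennreal] measurable_compose[OF _ borel_measurable_exp]
        borel_measurable_sum borel_measurable_diff borel_measurable_inner borel_measurable_divide
        borel_measurable_power measurable_compose[OF _ borel_measurable_norm] measurable_noise v) auto
  have "r * deviation \<theta> n k x y h \<le> ?L h + ?c" for h
  proof -
    have "(\<Sum>t<n. (norm (?v t h))\<^sup>2) \<le> (\<Sum>t<n. if t \<in> rounds k then r\<^sup>2 * W\<^sup>2 else 0)"
      using W by (intro sum_mono) (auto simp: power_mult_distrib intro!: mult_left_mono power_mono)
    also have "\<dots> = (\<Sum>t\<in>{..<n} \<inter> rounds k. r\<^sup>2 * W\<^sup>2)"
      by (simp add: sum.If_cases)
    also have "\<dots> \<le> (\<Sum>t\<in>rounds k. r\<^sup>2 * W\<^sup>2)"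
      by (intro sum_mono2) auto
    finally have *: "(\<Sum>t<n. (norm (?v t h))\<^sup>2) \<le> r\<^sup>2 * W\<^sup>2 * real (card X * m k)"
      by (simp add: card_rounds mult.commute)
    have "r * deviation \<theta> n k x y h = (\<Sum>t<n. ?v t h \<bullet> noise A \<theta> (h t))"
      unfolding deviation_def sum_distrib_left by (intro sum.cong) auto
    then show ?thesis
      using * unfolding sum_subtractf sum_divide_distrib[symmetric] by linarith
  qed
  then have "ennreal (exp (r * deviation \<theta> n k x y h)) \<le> ennreal (exp (?L h)) * ennreal (exp ?c)" for h
    by (simp add: ennreal_leI flip: ennreal_mult exp_add)
  then have "(\<integral>\<^sup>+h. ennreal (exp (r * deviation \<theta> n k x y h)) \<partial>?P) \<le> (\<integral>\<^sup>+h. ennreal (exp (?L h)) * ennreal (exp ?c) \<partial>?P)"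
    by (intro nn_integral_mono) auto
  also have "\<dots> = (\<integral>\<^sup>+h. ennreal (exp (?L h)) \<partial>?P) * ennreal (exp ?c)"
    by (rule nn_integral_multc[OF L])
  also have "(\<integral>\<^sup>+h. ennreal (exp (?L h)) \<partial>?P) = 1"
    by (rule nn_integral_exponential_martingale[where v = ?v, OF policy v upd])
  finally show ?thesis by simp
qed

text \<open>On its own turn a plausible action \<open>z\<close> is played, and its mean contribution
  is the inner product of \<open>A z *v w (plausible k h) x y z\<close> with
  \<open>\<theta>\<close>. Over \<open>m k\<close> sweeps these add up to \<open>m k\<close> times
  \<open>(x - y) \<bullet> \<theta>\<close>, and what remains is noise.\<close>

lemma estimate_eq_deviation:
  assumes follows: "\<And>t. t < n \<Longrightarrow> fst (h t) = action t h" and n: "start (Suc k) \<le> n"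
    and xy: "x - y = (\<Sum>z\<in>X. A z *v w (plausible k h) x y z)"
  shows "estimate k (plausible k h) x y h = (x - y) \<bullet> \<theta> + deviation \<theta> n k x y h / real (m k)"
proof -
  let ?S = "plausible k h"
  have "w ?S x y (arm t) \<bullet> snd (h t) = w ?S x y (arm t) \<bullet> noise A \<theta> (h t) + (A (arm t) *v w ?S x y (arm t)) \<bullet> \<theta>"
    if t: "t \<in> rounds k" for t
  \<comment> \<open>A turn outside \<open>?S\<close> may go to another action, but its weight is
    \<open>0\<close>, so both sides vanish.\<close>
  proof (cases "arm t \<in> ?S")
    case True
    have "fst (h t) = arm t"
      using follows[of t] t n phase_eqI[OF t] True by (simp add: rounds_def action_def pick_def)
    moreover have "w ?S x y (arm t) \<bullet> (transpose (A (arm t)) *v \<theta>) = (A (arm t) *v w ?S x y (arm t)) \<bullet> \<theta>"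
      by (simp add: transpose_matrix_vector dot_lmul_matrix inner_commute)
    ultimately show ?thesis
      by (simp add: noise_def inner_diff_right)
  qed (simp add: w_outside)
  then have "(\<Sum>t\<in>rounds k. w ?S x y (arm t) \<bullet> snd (h t)) =
      (\<Sum>t\<in>rounds k. w ?S x y (arm t) \<bullet> noise A \<theta> (h t)) + (\<Sum>t\<in>rounds k. A (arm t) *v w ?S x y (arm t)) \<bullet> \<theta>"
    by (simp add: sum.distrib inner_sum_left)
  also have "(\<Sum>t\<in>rounds k. A (arm t) *v w ?S x y (arm t)) = real (m k) *\<^sub>R (x - y)"
    by (simp only: sum_rounds_arm[of "\<lambda>z. A z *v w ?S x y z"] xy[symmetric])
  also have "(\<Sum>t\<in>rounds k. w ?S x y (arm t) \<bullet> noise A \<theta> (h t)) = deviation \<theta> n k x y h"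
  proof -
    have "{..<n} \<inter> rounds k = rounds k"
      using n by (auto simp: rounds_def)
    then show ?thesis
      by (simp add: deviation_def sum.If_cases)
  qed
  finally have "(\<Sum>t\<in>rounds k. w ?S x y (arm t) \<bullet> snd (h t)) = deviation \<theta> n k x y h + real (m k) * ((x - y) \<bullet> \<theta>)"
    by (simp only: inner_scaleR_left)
  then show ?thesis
    using m_pos[of k] by (simp add: estimate_def add_divide_distrib)
qed

text \<open>The tolerance \<open>2 * \<eta> k\<close> of \<open>refine\<close> splits into
  \<open>\<eta> k\<close> for the estimation error and \<open>\<eta> k\<close> for rounding to the
  grid.\<close>

lemma confidence_SucI:
  assumes "\<theta> \<in> confidence k h"
    and err: "\<And>x y. x \<in> plausible k h \<Longrightarrow> y \<in> plausible k h \<Longrightarrow>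
      \<bar>estimate k (plausible k h) x y h - (x - y) \<bullet> \<theta>\<bar> \<le> \<eta> k"
  shows "\<theta> \<in> confidence (Suc k) h"
proof -
  have round: "\<bar>v - \<eta> k * of_int \<lfloor>v / \<eta> k\<rfloor>\<bar> \<le> \<eta> k" for v
  proof -
    have "\<eta> k * of_int \<lfloor>v / \<eta> k\<rfloor> \<le> \<eta> k * (v / \<eta> k)" "\<eta> k * (v / \<eta> k) \<le> \<eta> k * (of_int \<lfloor>v / \<eta> k\<rfloor> + 1)"
      using \<eta>_pos[of k] by (intro mult_left_mono; linarith)+
    then have "\<eta> k * of_int \<lfloor>v / \<eta> k\<rfloor> \<le> v" "v \<le> \<eta> k * of_int \<lfloor>v / \<eta> k\<rfloor> + \<eta> k"
      using \<eta>_pos[of k] by (simp_all add: distrib_left)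
    then show ?thesis by linarith
  qed
  have "\<bar>(x - y) \<bullet> \<theta> - \<eta> k * of_int \<lfloor>estimate k (plausible k h) x y h / \<eta> k\<rfloor>\<bar> \<le> 2 * \<eta> k"
    if "x \<in> plausible k h" "y \<in> plausible k h" for x y
    using err[OF that] round[of "estimate k (plausible k h) x y h"] by linarith
  then show ?thesis
    using assms(1) by (simp add: refine_def)
qed

text \<open>For the pair \<open>?b\<close>, \<open>z\<close>, both \<open>\<theta>\<close> and a
  parameter \<open>\<theta>'\<close> at which \<open>z\<close> is optimal lie in the same slab of
  half-width \<open>2 * \<eta> k\<close>, so their reward differences are within
  \<open>4 * \<eta> k\<close>; at \<open>\<theta>'\<close> the difference is at most
  \<open>0\<close>.\<close>

lemma gap_le:
  assumes \<theta>: "\<theta> \<in> confidence (Suc k) h" and z: "z \<in> plausible (Suc k) h"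
  shows "(best_action X \<theta> - z) \<bullet> \<theta> \<le> 4 * \<eta> k"
proof -
  let ?b = "best_action X \<theta>"
  obtain \<theta>' where \<theta>': "\<theta>' \<in> confidence (Suc k) h" "z \<in> optimal_actions X \<theta>'"
    using z by (auto simp: optimal_actions_on_def simp del: confidence.simps)
  have b: "?b \<in> plausible (Suc k) h"
    using \<theta> best_action_optimal[OF X(1,2)] by (auto simp: optimal_actions_on_def simp del: confidence.simps)
  then have "?b \<in> plausible k h" "z \<in> plausible k h"
    using z plausible_mono by auto
  then have "\<bar>(?b - z) \<bullet> \<theta> - c\<bar> \<le> 2 * \<eta> k \<and> \<bar>(?b - z) \<bullet> \<theta>' - c\<bar> \<le> 2 * \<eta> k"
    if "c = \<eta> k * of_int \<lfloor>estimate k (plausible k h) ?b z h / \<eta> k\<rfloor>" for c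
    using \<theta> \<theta>'(1) that by (simp add: refine_def)
  then have "\<bar>(?b - z) \<bullet> \<theta> - (?b - z) \<bullet> \<theta>'\<bar> \<le> 4 * \<eta> k"
    by fastforce
  moreover have "(?b - z) \<bullet> \<theta>' \<le> 0"
    using \<theta>'(2) b optimal_actions_on_subset[of X] X(1)
    by (auto simp: optimal_actions_iff inner_diff_left simp del: confidence.simps)
  ultimately show ?thesis by linarith
qed

text \<open>Phase \<open>0\<close> starts without data, so only the trivial bound \<open>1\<close>
  is available; phase \<open>Suc j\<close> inherits the accuracy reached in phase
  \<open>j\<close>.\<close>

definition gap_bound :: "nat \<Rightarrow> real" where
  "gap_bound k = (case k of 0 \<Rightarrow> 1 | Suc j \<Rightarrow> 4 * \<eta> j)"

lemma gap_bound_nonneg: "0 \<le> gap_bound k"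
  using \<eta>_pos by (auto simp: gap_bound_def less_imp_le split: nat.split)

lemma sum_gap_bound_phase: "(\<Sum>t<start K. gap_bound (phase t)) = (\<Sum>k<K. real (card X * m k) * gap_bound k)"
proof (induction K)
  case (Suc K)
  have "start K \<le> start (Suc K)"
    by (intro monoD[OF mono_start]) simp
  then have "{..<start (Suc K)} = {..<start K} \<union> rounds K" "{..<start K} \<inter> rounds K = {}"
    by (auto simp: rounds_def)
  then have "(\<Sum>t<start (Suc K). gap_bound (phase t)) =
      (\<Sum>t<start K. gap_bound (phase t)) + (\<Sum>t\<in>rounds K. gap_bound (phase t))"
    by (simp add: sum.union_disjoint)
  also have "(\<Sum>t\<in>rounds K. gap_bound (phase t)) = (\<Sum>t\<in>rounds K. gap_bound K)"
    by (intro sum.cong) (auto simp: phase_eqI)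
  finally show ?case
    using Suc by (simp add: card_rounds)
qed simp

text \<open>The deterministic half of the analysis: small deviations keep \<open>\<theta>\<close> in
  every confidence set reached, and then each played action obeys \<open>gap_bound\<close>. The
  restriction \<open>Suc k < K\<close> appears because the estimates of the last phase are never
  acted upon.\<close>

lemma regret_le:
  assumes \<theta>: "\<theta> \<in> cball 0 1" and n: "n \<le> start K"
    and follows: "\<And>t. t < n \<Longrightarrow> fst (h t) = action t h"
    and rep: "\<And>k x y. Suc k < K \<Longrightarrow> x \<in> plausible k h \<Longrightarrow> y \<in> plausible k h \<Longrightarrow>
      x - y = (\<Sum>z\<in>X. A z *v w (plausible k h) x y z)"
    and dev: "\<And>k x y. Suc k < K \<Longrightarrow> x \<in> X \<Longrightarrow> y \<in> X \<Longrightarrow>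
      \<bar>deviation \<theta> n k x y h\<bar> \<le> real (m k) * \<eta> k"
  shows "regret X \<theta> n h \<le> (\<Sum>k<K. real (card X * m k) * gap_bound k)"
proof -
  \<comment> \<open>The condition \<open>start k \<le> n\<close> guarantees that the phases from
    which \<open>confidence k\<close> is built are complete.\<close>
  have conf: "\<theta> \<in> confidence k h" if "k < K" "start k \<le> n" for k
    using that
  proof (induction k)
    case (Suc k)
    have le: "start k \<le> start (Suc k)"
      by (intro monoD[OF mono_start]) simp
    show ?case
    proof (rule confidence_SucI)
      show "\<theta> \<in> confidence k h"
        using Suc le by simp
      fix x y assume xy: "x \<in> plausible k h" "y \<in> plausible k h"
      have "\<bar>deviation \<theta> n k x y h\<bar> / real (m k) \<le> \<eta> k"
        using dev[of k x y] Suc.prems(1) xy optimal_actions_on_subset[of X] m_pos[of k]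
        by (auto simp: pos_divide_le_eq mult.commute)
      then show "\<bar>estimate k (plausible k h) x y h - (x - y) \<bullet> \<theta>\<bar> \<le> \<eta> k"
        using estimate_eq_deviation[OF follows Suc.prems(2) rep[OF Suc.prems(1) xy], of \<theta>] by simp
    qed
  qed simp
  have "(best_action X \<theta> - fst (h t)) \<bullet> \<theta> \<le> gap_bound (phase t)" if t: "t < n" for t
  proof -
    have "start (phase t) < start K"
      using start_phase_le[of t] t n by linarith
    then have "phase t < K"
      using monoD[OF mono_start, of K "phase t"] by (meson not_le)
    then have \<theta>': "\<theta> \<in> confidence (phase t) h"
      using start_phase_le[of t] t by (intro conf) auto
    then have "best_action X \<theta> \<in> plausible (phase t) h"
      using best_action_optimal[OF X(1,2)] by (auto simp: optimal_actions_on_def)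
    then have act: "action t h \<in> plausible (phase t) h"
      unfolding action_def by (intro pick_in) auto
    show ?thesis
    proof (cases "phase t")
      case 0
      then show ?thesis
        using instantaneous_regret_bounds(2)[OF X(1,3) \<theta> action_in_X] follows[OF t]
        by (simp add: gap_bound_def)
    next
      case (Suc j)
      then show ?thesis
        using gap_le[of \<theta> j h "action t h"] \<theta>' act follows[OF t]
        by (simp add: gap_bound_def del: confidence.simps)
    qed
  qed
  then have "regret X \<theta> n h \<le> (\<Sum>t<n. gap_bound (phase t))"
    unfolding regret_def by (intro sum_mono) auto
  also have "\<dots> \<le> (\<Sum>t<start K. gap_bound (phase t))"
    using n gap_bound_nonneg by (intro sum_mono2) auto
  finally show ?thesis
    by (simp add: sum_gap_bound_phase)
qed

text \<open>Chernoff bound: \<open>l\<close> minimises the exponent \<open>l\<^sup>2 * W\<^sup>2 *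
  card X * m k / 2 - l * m k * \<eta> k\<close>, and the sign \<open>s\<close> covers both
  tails.\<close>

lemma nn_integral_deviation_tail:
  fixes s :: real and k :: nat
  assumes "s\<^sup>2 = 1"
  defines "l \<equiv> \<eta> k / (W\<^sup>2 * real (card X))"
  shows "(\<integral>\<^sup>+h. ennreal (exp (l * s * deviation \<theta> n k x y h - l * (real (m k) * \<eta> k))) \<partial>history_law X A policy \<theta> n) \<le>
     ennreal (exp (- (real (m k) * (\<eta> k)\<^sup>2 / (2 * W\<^sup>2 * real (card X)))))"
proof -
  let ?P = "history_law X A policy \<theta> n" and ?b = "l * (real (m k) * \<eta> k)"
  have meas: "(\<lambda>h. ennreal (exp (l * s * deviation \<theta> n k x y h))) \<in> borel_measurable ?P"
    unfolding measurable_cong_sets[OF sets_history_law[OF policy] refl]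
    by (intro measurable_compose[OF _ measurable_ennreal] measurable_compose[OF _ borel_measurable_exp]
        borel_measurable_times borel_measurable_const measurable_deviation)
  have "(\<integral>\<^sup>+h. ennreal (exp (l * s * deviation \<theta> n k x y h - ?b)) \<partial>?P) =
      (\<integral>\<^sup>+h. ennreal (exp (l * s * deviation \<theta> n k x y h)) * ennreal (exp (- ?b)) \<partial>?P)"
    by (simp flip: ennreal_mult exp_add)
  also have "\<dots> = (\<integral>\<^sup>+h. ennreal (exp (l * s * deviation \<theta> n k x y h)) \<partial>?P) * ennreal (exp (- ?b))"
    by (rule nn_integral_multc[OF meas])
  also have "\<dots> \<le> ennreal (exp ((l * s)\<^sup>2 * W\<^sup>2 * real (card X * m k) / 2)) * ennreal (exp (- ?b))"
    by (intro mult_right_mono nn_integral_exp_deviation) simp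
  also have "\<dots> = ennreal (exp ((l * s)\<^sup>2 * W\<^sup>2 * real (card X * m k) / 2 - ?b))"
    by (simp flip: ennreal_mult exp_add)
  also have "(l * s)\<^sup>2 * W\<^sup>2 * real (card X * m k) / 2 - ?b = - (real (m k) * (\<eta> k)\<^sup>2 / (2 * W\<^sup>2 * real (card X)))"
    using W(1) card_X_pos assms(1) by (simp add: l_def power_mult_distrib divide_simps) (simp add: power2_eq_square power4_eq_xxxx algebra_simps)
  finally show ?thesis .
qed

text \<open>In place of a union bound over events, the exponential terms \<open>E j\<close> enter
  the pointwise estimate directly: either one of them is at least \<open>1\<close> and absorbs the
  trivial bound \<open>n\<close> on the regret, or all deviations are small and
  \<open>regret_le\<close> applies. Only the mean of each \<open>E j\<close> is then needed.\<close>

lemma expected_regret_le: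
  assumes \<theta>: "\<theta> \<in> cball 0 1" and n: "n \<le> start K"
    and rep: "\<And>k x y h. Suc k < K \<Longrightarrow> x \<in> plausible k h \<Longrightarrow> y \<in> plausible k h \<Longrightarrow>
      x - y = (\<Sum>z\<in>X. A z *v w (plausible k h) x y z)"
    and p: "0 \<le> p" "\<And>k. Suc k < K \<Longrightarrow> exp (- (real (m k) * (\<eta> k)\<^sup>2 / (2 * W\<^sup>2 * real (card X)))) \<le> p"
  shows "expected_regret X A policy \<theta> n \<le>
    (\<Sum>k<K. real (card X * m k) * gap_bound k) + real n * (2 * real (K - 1) * (real (card X))\<^sup>2 * p)"
proof -
  let ?P = "history_law X A policy \<theta> n" and ?B = "\<Sum>k<K. real (card X * m k) * gap_bound k"
  define l where "l k = \<eta> k / (W\<^sup>2 * real (card X))" for k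
  \<comment> \<open>One index for each phase whose estimates are used, each pair of actions and each
    tail; its size is the factor \<open>2 * real (K - 1) * (real (card X))\<^sup>2\<close> in the
    claim.\<close>
  define J where "J = {..<K - 1} \<times> X \<times> X \<times> {1, -1::real}"
  define E where "E = (\<lambda>(k, x, y, s) h. exp (l k * s * deviation \<theta> n k x y h - l k * (real (m k) * \<eta> k)))"
  have fin: "finite J"
    using X(1) by (simp add: J_def)
  have cardJ: "card J = (K - 1) * (card X * (card X * 2))"
    by (simp add: J_def card_cartesian_product)
  have E: "(\<lambda>h. ennreal (E j h)) \<in> borel_measurable ?P" for j
    unfolding measurable_cong_sets[OF sets_history_law[OF policy] refl] E_def split_beta
    by (intro measurable_compose[OF _ measurable_ennreal] measurable_compose[OF _ borel_measurable_exp]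
        borel_measurable_diff borel_measurable_times borel_measurable_const measurable_deviation)
  have B: "0 \<le> ?B"
    using gap_bound_nonneg by (intro sum_nonneg mult_nonneg_nonneg) auto
  have "AE h in ?P. ennreal (regret X \<theta> n h) \<le> ennreal ?B + ennreal (real n) * (\<Sum>j\<in>J. ennreal (E j h))"
    using AE_follows_policy[where \<theta> = \<theta> and n = n]
  proof eventually_elim
    case (elim h)
    have le_n: "regret X \<theta> n h \<le> real n"
      using sum_bounded_above[of "{..<n}" "\<lambda>t. (best_action X \<theta> - fst (h t)) \<bullet> \<theta>" 1]
        instantaneous_regret_bounds(2)[OF X(1,3) \<theta> action_in_X] elim
      by (simp add: regret_def)
    have "regret X \<theta> n h \<le> ?B + real n * (\<Sum>j\<in>J. E j h)"
    proof (cases "\<exists>j\<in>J. 1 \<le> E j h")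
      case True
      then obtain j where "j \<in> J" "1 \<le> E j h" by blast
      then have "1 \<le> (\<Sum>j\<in>J. E j h)"
        using fin member_le_sum[of j J "\<lambda>j. E j h"] by (force simp: E_def)
      from mult_left_mono[OF this, of "real n"] show ?thesis
        using le_n B by simp
    next
      case False
      have "\<bar>deviation \<theta> n k x y h\<bar> \<le> real (m k) * \<eta> k" if "Suc k < K" "x \<in> X" "y \<in> X" for k x y
      proof (rule ccontr)
        assume *: "\<not> ?thesis"
        have "0 < l k"
          using \<eta>_pos W(1) card_X_pos by (simp add: l_def)
        have "\<exists>s\<in>{1, -1}. real (m k) * \<eta> k \<le> s * deviation \<theta> n k x y h"
          using * by (auto simp: abs_real_def split: if_splits)
        then obtain s where s: "s \<in> {1, -1}" "real (m k) * \<eta> k \<le> s * deviation \<theta> n k x y h"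
          by blast
        have "1 \<le> E (k, x, y, s) h"
          using mult_left_mono[OF s(2), of "l k"] \<open>0 < l k\<close> by (simp add: E_def mult.assoc)
        moreover have "(k, x, y, s) \<in> J"
          using that s(1) by (auto simp: J_def)
        ultimately show False
          using False by blast
      qed
      then have "regret X \<theta> n h \<le> ?B"
        using elim rep by (intro regret_le[OF \<theta> n]) auto
      moreover have "0 \<le> real n * (\<Sum>j\<in>J. E j h)"
        by (intro mult_nonneg_nonneg sum_nonneg) (auto simp: E_def)
      ultimately show ?thesis by linarith
    qed
    then have "ennreal (regret X \<theta> n h) \<le> ennreal (?B + real n * (\<Sum>j\<in>J. E j h))"
      by (rule ennreal_leI)
    also have "\<dots> = ennreal ?B + ennreal (real n) * (\<Sum>j\<in>J. ennreal (E j h))"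
    proof -
      have "0 \<le> E j h" for j
        by (simp add: E_def split_beta)
      then have "(\<Sum>j\<in>J. ennreal (E j h)) = ennreal (\<Sum>j\<in>J. E j h)" "0 \<le> (\<Sum>j\<in>J. E j h)"
        by (auto intro!: sum_ennreal sum_nonneg)
      then show ?thesis
        using B by (simp only: ennreal_plus ennreal_mult mult_nonneg_nonneg of_nat_0_le_iff)
    qed
    finally show ?case .
  qed
  then have "(\<integral>\<^sup>+h. ennreal (regret X \<theta> n h) \<partial>?P) \<le> (\<integral>\<^sup>+h. ennreal ?B + ennreal (real n) * (\<Sum>j\<in>J. ennreal (E j h)) \<partial>?P)"
    by (rule nn_integral_mono_AE)
  also have "\<dots> = (\<integral>\<^sup>+h. ennreal ?B \<partial>?P) + ennreal (real n) * (\<Sum>j\<in>J. \<integral>\<^sup>+h. ennreal (E j h) \<partial>?P)"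
  proof -
    have S: "(\<lambda>h. \<Sum>j\<in>J. ennreal (E j h)) \<in> borel_measurable ?P"
      by (intro borel_measurable_sum E)
    show ?thesis
      unfolding nn_integral_add[OF borel_measurable_const borel_measurable_times_ennreal[OF borel_measurable_const S]]
        nn_integral_cmult[OF S] nn_integral_sum[OF E] ..
  qed
  also have "(\<integral>\<^sup>+h. ennreal ?B \<partial>?P) = ennreal ?B"
    by (simp add: prob_space.emeasure_space_1[OF prob_space_history_law[OF policy]])
  also have "(\<Sum>j\<in>J. \<integral>\<^sup>+h. ennreal (E j h) \<partial>?P) \<le> (\<Sum>j\<in>J. ennreal p)"
  proof (intro sum_mono)
    fix j assume "j \<in> J"
    then obtain k x y s where j: "j = (k, x, y, s)" "Suc k < K" "s\<^sup>2 = 1"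
      by (auto simp: J_def)
    show "(\<integral>\<^sup>+h. ennreal (E j h) \<partial>?P) \<le> ennreal p"
      unfolding j(1) E_def prod.case l_def
      by (rule order_trans[OF nn_integral_deviation_tail[OF j(3)] ennreal_leI[OF p(2)[OF j(2)]]])
  qed
  also have "ennreal ?B + ennreal (real n) * (\<Sum>j\<in>J. ennreal p) =
      ennreal (?B + real n * (2 * real (K - 1) * (real (card X))\<^sup>2 * p))"
  proof -
    have "(\<Sum>j\<in>J. ennreal p) = ennreal (2 * real (K - 1) * (real (card X))\<^sup>2 * p)"
      using p(1) by (subst sum_ennreal) (simp_all add: cardJ power2_eq_square mult_ac)
    then show ?thesis
      using B p(1) by (simp only: ennreal_plus ennreal_mult mult_nonneg_nonneg of_nat_0_le_iff zero_le_power2 zero_le_numeral)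
  qed
  finally have "ennreal (expected_regret X A policy \<theta> n) \<le> \<dots>"
    by (simp add: mult_left_mono add_left_mono nn_integral_regret[OF X(1,3) \<theta> policy])
  then show ?thesis
    using B p(1) by (subst (asm) ennreal_le_iff) (auto intro!: add_nonneg_nonneg mult_nonneg_nonneg)
qed

lemma minimax_regret_le:
  assumes n: "n \<le> start K"
    and rep: "\<And>k x y h. Suc k < K \<Longrightarrow> x \<in> plausible k h \<Longrightarrow> y \<in> plausible k h \<Longrightarrow>
      x - y = (\<Sum>z\<in>X. A z *v w (plausible k h) x y z)"
    and p: "0 \<le> p" "\<And>k. Suc k < K \<Longrightarrow> exp (- (real (m k) * (\<eta> k)\<^sup>2 / (2 * W\<^sup>2 * real (card X)))) \<le> p"
  shows "minimax_regret X A n \<le>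
    (\<Sum>k<K. real (card X * m k) * gap_bound k) + real n * (2 * real (K - 1) * (real (card X))\<^sup>2 * p)"
  unfolding minimax_regret_def
proof (rule cINF_lower2[OF _ policy])
  show "(SUP \<theta>\<in>cball 0 1. expected_regret X A policy \<theta> n) \<le>
      (\<Sum>k<K. real (card X * m k) * gap_bound k) + real n * (2 * real (K - 1) * (real (card X))\<^sup>2 * p)"
    by (intro cSUP_least expected_regret_le n rep p) auto
  show "bdd_below ((\<lambda>\<pi>. SUP \<theta>\<in>cball 0 1. expected_regret X A \<pi> \<theta> n) ` policies X)"
  proof (rule bdd_belowI2[where m = 0])
    fix \<pi> :: "nat \<Rightarrow> (nat \<Rightarrow> (real^'d) \<times> (real^'m)) \<Rightarrow> (real^'d) measure"
    assume \<pi>: "\<pi> \<in> policies X"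
    have bounds: "expected_regret X A \<pi> \<theta> n \<in> {0..real n}" if "\<theta> \<in> cball 0 1" for \<theta>
      by (rule expected_regret_bounds(3)[OF X(1,3) that \<pi>])
    then have "expected_regret X A \<pi> 0 n \<le> (SUP \<theta>\<in>cball 0 1. expected_regret X A \<pi> \<theta> n)"
      by (intro cSUP_upper bdd_aboveI2[where M = "real n"]) auto
    then show "0 \<le> (SUP \<theta>\<in>cball 0 1. expected_regret X A \<pi> \<theta> n)"
      using bounds[of 0] by simp
  qed
qed

end

section \<open>Rates\<close>

text \<open>The accuracies are fixed so that every tail is at most
  \<open>1 / (real n)\<^sup>2\<close>. Observability is asked of convex sets, and in phase
  \<open>0\<close> of the whole space alone, so that one statement serves both locally and globally
  observable games.\<close>

lemma phased_elimination_bound: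
  fixes X :: "(real^'d) set" and A :: "real^'d \<Rightarrow> real^'m^'d"
  assumes X: "finite X" "X \<noteq> {}" "diameter X \<le> 1"
  obtains V :: real where "0 < V"
    "\<And>n m K. 2 \<le> n \<Longrightarrow> (\<And>k. 0 < m k) \<Longrightarrow> n \<le> card X * (\<Sum>j<K. m j) \<Longrightarrow>
      (\<And>k \<C> x y. Suc k < K \<Longrightarrow> convex \<C> \<Longrightarrow> (k = 0 \<Longrightarrow> \<C> = UNIV) \<Longrightarrow>
        x \<in> optimal_actions_on X \<C> \<Longrightarrow> y \<in> optimal_actions_on X \<C> \<Longrightarrow>
        x - y \<in> feedback_span A (optimal_actions_on X \<C>)) \<Longrightarrow>
      minimax_regret X A n \<le>
        (\<Sum>k<K. real (card X * m k) * (case k of 0 \<Rightarrow> 1 | Suc j \<Rightarrow> V * sqrt (ln (real n) / real (m j))))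
          + 2 * real (K - 1) * (real (card X))\<^sup>2 / real n"
proof (rule bounded_weights_exist[OF X(1), of A])
  fix w :: "(real^'d) set \<Rightarrow> real^'d \<Rightarrow> real^'d \<Rightarrow> real^'d \<Rightarrow> real^'m" and W :: real
  assume W: "0 < W" "\<And>S x y z. norm (w S x y z) \<le> W" "\<And>S x y z. z \<notin> S \<Longrightarrow> w S x y z = 0"
    and w: "\<And>S x y. S \<subseteq> X \<Longrightarrow> x \<in> S \<Longrightarrow> y \<in> S \<Longrightarrow> x - y \<in> feedback_span A S \<Longrightarrow>
      x - y = (\<Sum>z\<in>X. A z *v w S x y z)"
  obtain e where e: "bij_betw e {..<card X} X"
    using ex_bij_betw_nat_finite[OF X(1)] by (auto simp: atLeast0LessThan)
  have N: "0 < card X"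
    using X by (simp add: card_gt_0_iff)
  show thesis
  \<comment> \<open>The factor \<open>8\<close> is the \<open>2\<close> in \<open>\<eta>\<close>
    times the \<open>4\<close> in \<open>gap_bound\<close>.\<close>
  proof (rule that[of "8 * W * sqrt (card X)"])
    show "0 < 8 * W * sqrt (card X)"
      using W(1) N by simp
    fix n K :: nat and m :: "nat \<Rightarrow> nat"
    assume n: "2 \<le> n" "n \<le> card X * (\<Sum>j<K. m j)" and m: "\<And>k. 0 < m k"
      and obs: "\<And>k \<C> x y. Suc k < K \<Longrightarrow> convex \<C> \<Longrightarrow> (k = 0 \<Longrightarrow> \<C> = UNIV) \<Longrightarrow>
        x \<in> optimal_actions_on X \<C> \<Longrightarrow> y \<in> optimal_actions_on X \<C> \<Longrightarrow>
        x - y \<in> feedback_span A (optimal_actions_on X \<C>)"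
    have ln: "0 < ln (real n)"
      using n(1) by simp
    \<comment> \<open>Chosen so that the Chernoff exponent is \<open>2 * ln (real n)\<close>; the
      failure term then keeps a factor \<open>1 / real n\<close> after multiplication by the
      horizon.\<close>
    define \<eta> where "\<eta> k = 2 * W * sqrt (card X * (ln (real n) / real (m k)))" for k
    have \<eta>: "0 < \<eta> k" for k
      using W(1) N m[of k] ln by (simp add: \<eta>_def)
    interpret phased_elimination X A e m \<eta> w W
      by unfold_locales (use X e m \<eta> W in auto)
    have "real (m k) * (\<eta> k)\<^sup>2 / (2 * W\<^sup>2 * real (card X)) = 2 * ln (real n)" for k
      using W(1) N m[of k] ln by (simp add: \<eta>_def power_mult_distrib)
    then have p: "exp (- (real (m k) * (\<eta> k)\<^sup>2 / (2 * W\<^sup>2 * real (card X)))) \<le> 1 / (real n)\<^sup>2" for k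
      using n(1) by (simp add: exp_minus exp_double inverse_eq_divide)
    have "minimax_regret X A n \<le>
      (\<Sum>k<K. real (card X * m k) * gap_bound k) + real n * (2 * real (K - 1) * (real (card X))\<^sup>2 * (1 / (real n)\<^sup>2))"
    proof (rule minimax_regret_le)
      show "n \<le> start K"
        using n(2) by (simp add: start_def)
      show "x - y = (\<Sum>z\<in>X. A z *v w (plausible k h) x y z)"
        if "Suc k < K" "x \<in> plausible k h" "y \<in> plausible k h" for k x y h
        using that by (intro w optimal_actions_on_subset obs[of k] convex_confidence) auto
    qed (use p in auto)
    also have "real n * (2 * real (K - 1) * (real (card X))\<^sup>2 * (1 / (real n)\<^sup>2)) = 2 * real (K - 1) * (real (card X))\<^sup>2 / real n"
      using n(1) by (simp add: power2_eq_square)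
    also have "gap_bound = (\<lambda>k. case k of 0 \<Rightarrow> 1 | Suc j \<Rightarrow> 8 * W * sqrt (card X) * sqrt (ln (real n) / real (m j)))"
      by (auto simp: fun_eq_iff gap_bound_def \<eta>_def mult.assoc split: nat.split simp flip: real_sqrt_mult)
    finally show "minimax_regret X A n \<le>
        (\<Sum>k<K. real (card X * m k) * (case k of 0 \<Rightarrow> 1 | Suc j \<Rightarrow> 8 * W * sqrt (card X) * sqrt (ln (real n) / real (m j))))
          + 2 * real (K - 1) * (real (card X))\<^sup>2 / real n" .
  qed
qed

text \<open>The two-point bound with \<open>u = 0\<close> and \<open>c = 0\<close> degenerates to
  this.\<close>

lemma minimax_regret_nonneg:
  assumes "finite X" "X \<noteq> {}" "diameter X \<le> 1"
  shows "0 \<le> minimax_regret X A n"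
proof -
  obtain x where "x \<in> X"
    using assms(2) by auto
  then show ?thesis
    using minimax_regret_ge[OF assms, of 0 0 x x 0 0 0 A n] assms(1) by (simp add: optimal_actions_0)
qed

lemma one_le_ln: "3 \<le> n \<Longrightarrow> 1 \<le> ln (real n)"
  using exp_le by (subst ln_ge_iff) auto

section \<open>Upper bounds for observable games\<close>

context
  fixes X :: "(real^'d) set" and A :: "real^'d \<Rightarrow> real^'m^'d"
  assumes X: "finite X" "X \<noteq> {}" "diameter X \<le> 1"
begin

lemma minimax_regret_bigoI:
  assumes "\<And>n. 3 \<le> n \<Longrightarrow> minimax_regret X A n \<le> C * (real n powr a * ln (real n))"
  shows "minimax_regret X A \<in> O(\<lambda>n. real n powr a * ln (real n))"
proof (rule landau_o.bigI[of "max C 1"])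
  show "\<forall>\<^sub>F n in sequentially. norm (minimax_regret X A n) \<le> max C 1 * norm (real n powr a * ln (real n))"
    using eventually_ge_at_top[of "3::nat"]
  proof eventually_elim
    case (elim n)
    have "minimax_regret X A n \<le> max C 1 * (real n powr a * ln (real n))"
      using one_le_ln[OF elim]
      by (intro order_trans[OF assms[OF elim]] mult_right_mono mult_nonneg_nonneg) auto
    then show ?case
      using one_le_ln[OF elim] minimax_regret_nonneg[OF X, of A n] by simp
  qed
qed simp

text \<open>With \<open>4 ^ k\<close> sweeps in phase \<open>k\<close> the accuracy halves from
  phase to phase, so the regret bound of a later phase \<open>k\<close> is of order
  \<open>2 ^ k * sqrt (ln (real n))\<close>; the geometric sum is dominated by the last phase
  \<open>j\<close>, for which \<open>2 ^ j \<le> 2 * sqrt (real n)\<close>.\<close>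

lemma minimax_regret_locally_observable:
  assumes "locally_observable X A"
  shows "minimax_regret X A \<in> O(\<lambda>n. real n powr (1 / 2) * ln (real n))"
proof -
  obtain V where V: "0 < V" and bound:
    "\<And>n m K. 2 \<le> n \<Longrightarrow> (\<And>k. 0 < m k) \<Longrightarrow> n \<le> card X * (\<Sum>j<K. m j) \<Longrightarrow>
      (\<And>k \<C> x y. Suc k < K \<Longrightarrow> convex \<C> \<Longrightarrow> (k = 0 \<Longrightarrow> \<C> = UNIV) \<Longrightarrow>
        x \<in> optimal_actions_on X \<C> \<Longrightarrow> y \<in> optimal_actions_on X \<C> \<Longrightarrow>
        x - y \<in> feedback_span A (optimal_actions_on X \<C>)) \<Longrightarrow>
      minimax_regret X A n \<le>
        (\<Sum>k<K. real (card X * m k) * (case k of 0 \<Rightarrow> 1 | Suc j \<Rightarrow> V * sqrt (ln (real n) / real (m j))))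
          + 2 * real (K - 1) * (real (card X))\<^sup>2 / real n"
    by (rule phased_elimination_bound[OF X, of A]) blast
  let ?N = "real (card X)"
  have N: "1 \<le> card X"
    using X by (simp add: Suc_leI card_gt_0_iff)
  have "minimax_regret X A n \<le> (?N + 8 * ?N * V + 2 * ?N\<^sup>2) * (real n powr (1 / 2) * ln (real n))" if n: "3 \<le> n" for n
  proof -
    have ln: "1 \<le> ln (real n)" and sqrt: "1 \<le> sqrt (real n)"
      using one_le_ln[OF n] n by auto
    have le: "n \<le> 4 ^ n"
      using less_exp[of n] power_mono[of "2::nat" 4 n] by simp
    \<comment> \<open>Phase \<open>j\<close> alone is long enough for the horizon, which gives
      \<open>Suc j\<close> phases; minimality bounds \<open>2 ^ j\<close>.\<close>
    define j where "j = (LEAST j. n \<le> 4 ^ j)"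
    have j: "n \<le> 4 ^ j" "\<And>i. i < j \<Longrightarrow> \<not> n \<le> 4 ^ i" "j \<le> n"
      unfolding j_def using LeastI[of "\<lambda>j. n \<le> 4 ^ j", OF le] not_less_Least Least_le[of "\<lambda>j. n \<le> 4 ^ j", OF le]
      by blast+
    have "2 ^ j \<le> 2 * sqrt (real n)"
    proof (cases j)
      case 0
      then show ?thesis
        unfolding \<open>j = 0\<close> power_0 using sqrt by linarith
    next
      case (Suc i)
      then have "4 ^ i \<le> n"
        using j(2)[of i] by simp
      then have "real (4 ^ i) \<le> real n"
        by (rule of_nat_mono)
      then have "sqrt (4 ^ i) \<le> sqrt (real n)"
        by simp
      then show ?thesis
        by (simp add: Suc real_sqrt_power)
    qed
    have "minimax_regret X A n \<le>
        (\<Sum>k<Suc j. real (card X * 4 ^ k) * (case k of 0 \<Rightarrow> 1 | Suc i \<Rightarrow> V * sqrt (ln (real n) / real (4 ^ i))))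
          + 2 * real (Suc j - 1) * ?N\<^sup>2 / real n"
    proof (rule bound)
      have "n \<le> (\<Sum>i<Suc j. 4 ^ i)"
        using j(1) by simp
      also have "\<dots> \<le> card X * (\<Sum>i<Suc j. 4 ^ i)"
        using N by simp
      finally show "n \<le> card X * (\<Sum>i<Suc j. 4 ^ i)" .
    qed (use n assms in \<open>auto simp: locally_observable_def\<close>)
    also have "(\<Sum>k<Suc j. real (card X * 4 ^ k) * (case k of 0 \<Rightarrow> 1 | Suc i \<Rightarrow> V * sqrt (ln (real n) / real (4 ^ i)))) =
        ?N + (\<Sum>i<j. 4 * ?N * V * sqrt (ln (real n)) * 2 ^ i)"
    proof -
      have eq: "real (card X * 4 ^ Suc i) * (V * sqrt (ln (real n) / real (4 ^ i))) = 4 * ?N * V * sqrt (ln (real n)) * 2 ^ i" for i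
      proof -
        have "(4::real) ^ i = 2 ^ i * 2 ^ i"
          by (simp flip: power_mult_distrib)
        then show ?thesis
          by (simp add: real_sqrt_divide real_sqrt_mult)
      qed
      show ?thesis
        unfolding sum.lessThan_Suc_shift nat.case eq by simp
    qed
    also have "(\<Sum>i<j. 4 * ?N * V * sqrt (ln (real n)) * 2 ^ i) = 4 * ?N * V * sqrt (ln (real n)) * (2 ^ j - 1)"
      by (simp add: sum_distrib_left[symmetric] geometric_sum)
    also have "\<dots> \<le> 4 * ?N * V * sqrt (ln (real n)) * (2 * sqrt (real n))"
      using \<open>2 ^ j \<le> 2 * sqrt (real n)\<close> V ln by (intro mult_left_mono) auto
    also have "\<dots> = 8 * ?N * V * (sqrt (real n) * sqrt (ln (real n)))"
      by simp
    also have "\<dots> \<le> 8 * ?N * V * (sqrt (real n) * ln (real n))"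
      using V ln by (intro mult_left_mono mult_nonneg_nonneg) (auto simp: sqrt_le_D real_le_lsqrt power2_eq_square)
    also have "2 * real (Suc j - 1) * ?N\<^sup>2 / real n \<le> 2 * ?N\<^sup>2"
      using j(3) n mult_left_mono[of "real j" "real n" "?N\<^sup>2"] by (simp add: pos_divide_le_eq mult.commute)
    finally have "minimax_regret X A n \<le> ?N * 1 + 8 * ?N * V * (sqrt (real n) * ln (real n)) + 2 * ?N\<^sup>2 * 1"
      by simp
    also have "\<dots> \<le> ?N * (sqrt (real n) * ln (real n)) + 8 * ?N * V * (sqrt (real n) * ln (real n)) + 2 * ?N\<^sup>2 * (sqrt (real n) * ln (real n))"
      using mult_mono[OF sqrt ln] V by (intro add_mono mult_left_mono) auto
    finally show ?thesis
      by (simp add: powr_half_sqrt algebra_simps)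
  qed
  then show ?thesis
    by (intro minimax_regret_bigoI) auto
qed

text \<open>Explore, then commit: about \<open>real n powr (2 / 3)\<close> sweeps at gap at most
  \<open>1\<close>, and afterwards gaps of order
  \<open>sqrt (ln (real n)) / real n powr (1 / 3)\<close>, balance each other up to the logarithm.
  Only the estimates of phase \<open>0\<close> are used, in which all actions are plausible.\<close>

lemma minimax_regret_globally_observable:
  assumes "globally_observable X A"
  shows "minimax_regret X A \<in> O(\<lambda>n. real n powr (2 / 3) * ln (real n))"
proof -
  obtain V where V: "0 < V" and bound:
    "\<And>n m K. 2 \<le> n \<Longrightarrow> (\<And>k. 0 < m k) \<Longrightarrow> n \<le> card X * (\<Sum>j<K. m j) \<Longrightarrow>
      (\<And>k \<C> x y. Suc k < K \<Longrightarrow> convex \<C> \<Longrightarrow> (k = 0 \<Longrightarrow> \<C> = UNIV) \<Longrightarrow>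
        x \<in> optimal_actions_on X \<C> \<Longrightarrow> y \<in> optimal_actions_on X \<C> \<Longrightarrow>
        x - y \<in> feedback_span A (optimal_actions_on X \<C>)) \<Longrightarrow>
      minimax_regret X A n \<le>
        (\<Sum>k<K. real (card X * m k) * (case k of 0 \<Rightarrow> 1 | Suc j \<Rightarrow> V * sqrt (ln (real n) / real (m j))))
          + 2 * real (K - 1) * (real (card X))\<^sup>2 / real n"
    by (rule phased_elimination_bound[OF X, of A]) blast
  let ?N = "real (card X)"
  have N: "1 \<le> card X"
    using X by (simp add: Suc_leI card_gt_0_iff)
  \<comment> \<open>The zero parameter makes every action optimal.\<close>
  have all: "optimal_actions_on X UNIV = X"
    using optimal_actions_on_subset[of X UNIV] optimal_actions_0[OF X(1)] by (auto simp: optimal_actions_on_def)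
  have "minimax_regret X A n \<le> (2 * ?N + ?N * V + 2 * ?N\<^sup>2) * (real n powr (2 / 3) * ln (real n))" if n: "3 \<le> n" for n
  proof -
    have ln: "1 \<le> ln (real n)"
      using one_le_ln[OF n] .
    define r where "r = real n powr (2 / 3)"
    have r: "1 \<le> r"
      using n powr_mono[of 0 "2 / 3" "real n"] by (simp add: r_def)
    \<comment> \<open>The second phase is long enough for the whole horizon; the values at later
      indices only keep every phase nonempty.\<close>
    define m where "m k = (case k of 0 \<Rightarrow> nat \<lceil>r\<rceil> | Suc _ \<Rightarrow> n)" for k :: nat
    have m0: "r \<le> real (m 0)" "real (m 0) \<le> 2 * r" and m1: "m 1 = n"
      using r unfolding m_def by (simp_all, linarith+)
    have m_pos: "0 < m k" for k
      using r n by (auto simp: m_def split: nat.split)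
    have "minimax_regret X A n \<le>
        (\<Sum>k<2. real (card X * m k) * (case k of 0 \<Rightarrow> 1 | Suc j \<Rightarrow> V * sqrt (ln (real n) / real (m j))))
          + 2 * real (2 - 1) * ?N\<^sup>2 / real n"
    proof (rule bound)
      have "n \<le> (\<Sum>j<2. m j)"
        using m1 by (simp add: numeral_2_eq_2)
      also have "\<dots> \<le> card X * (\<Sum>j<2. m j)"
        using N by simp
      finally show "n \<le> card X * (\<Sum>j<2. m j)" .
      show "x - y \<in> feedback_span A (optimal_actions_on X \<C>)"
        if "Suc k < 2" "convex \<C>" "k = 0 \<Longrightarrow> \<C> = UNIV" "x \<in> optimal_actions_on X \<C>" "y \<in> optimal_actions_on X \<C>"
        for k \<C> x y
      proof -
        have "\<C> = UNIV"
          using that by simp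
        then show ?thesis
          using that assms by (simp add: all globally_observable_def)
      qed
    qed (use n m_pos in auto)
    also have "\<dots> = ?N * real (m 0) + ?N * V * (real n * sqrt (ln (real n) / real (m 0))) + 2 * ?N\<^sup>2 / real n"
      using m1 by (simp add: numeral_2_eq_2)
    also have "real n * sqrt (ln (real n) / real (m 0)) \<le> r * ln (real n)"
    proof -
      have "sqrt (ln (real n) / real (m 0)) \<le> sqrt (ln (real n) / r)"
        using m0(1) r ln by (intro real_sqrt_le_mono divide_left_mono) auto
      also have "\<dots> = sqrt (ln (real n)) / real n powr (1 / 3)"
        by (simp add: r_def real_sqrt_divide powr_half_sqrt[symmetric] powr_powr)
      also have "\<dots> \<le> ln (real n) / real n powr (1 / 3)"
        using ln by (intro divide_right_mono) (auto simp: real_le_lsqrt power2_eq_square)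
      finally have "real n * sqrt (ln (real n) / real (m 0)) \<le> real n * (ln (real n) / real n powr (1 / 3))"
        by (intro mult_left_mono) auto
      also have "\<dots> = real n powr (1 - 1 / 3) * ln (real n)"
        using n powr_diff[of "real n" 1 "1 / 3"] by simp
      finally show ?thesis
        by (simp add: r_def)
    qed
    finally have "minimax_regret X A n \<le> ?N * real (m 0) + ?N * V * (r * ln (real n)) + 2 * ?N\<^sup>2 / real n"
      using V by (simp add: mult_left_mono)
    also have "\<dots> \<le> ?N * (2 * (r * ln (real n))) + ?N * V * (r * ln (real n)) + 2 * ?N\<^sup>2 * (r * ln (real n))"
    proof (intro add_mono mult_left_mono)
      show "real (m 0) \<le> 2 * (r * ln (real n))"
        using m0(2) mult_left_mono[OF ln order_trans[OF zero_le_one r]] by linarith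
      have "2 * ?N\<^sup>2 / real n \<le> 2 * ?N\<^sup>2 * 1"
        using n mult_left_mono[of 1 "real n" "?N\<^sup>2"] by (simp add: pos_divide_le_eq)
      also have "\<dots> \<le> 2 * ?N\<^sup>2 * (r * ln (real n))"
        using mult_mono[OF r ln] r by (intro mult_left_mono) auto
      finally show "2 * ?N\<^sup>2 / real n \<le> 2 * ?N\<^sup>2 * (r * ln (real n))" .
    qed (use V r in auto)
    finally show ?thesis
      by (simp add: r_def algebra_simps)
  qed
  then show ?thesis
    by (intro minimax_regret_bigoI) auto
qed

end

text \<open>The exponent \<open>1\<close> of the logarithm serves both sides: dividing the lower
  rate by \<open>ln (real n)\<close> only weakens it, as this logarithm is at least \<open>1\<close>
  from \<open>n = 3\<close> on.\<close>

lemma soft_bigthetaI: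
  fixes f g :: "nat \<Rightarrow> real"
  assumes "f \<in> O(\<lambda>n. g n * ln (real n))" "f \<in> \<Omega>(g)"
  shows "f \<in> soft_bigtheta g"
proof -
  have "g \<in> \<Omega>(\<lambda>n. g n / ln (real n))"
  proof (rule landau_omega.bigI[of 1])
    show "\<forall>\<^sub>F n in sequentially. 1 * norm (g n / ln (real n)) \<le> norm (g n)"
      using eventually_ge_at_top[of "3::nat"]
    proof eventually_elim
      case (elim n)
      then show ?case
        using one_le_ln[OF elim] mult_left_mono[of 1 "ln (real n)" "\<bar>g n\<bar>"] by (simp add: pos_divide_le_eq)
    qed
  qed simp
  with assms(2) have "f \<in> \<Omega>(\<lambda>n. g n / ln (real n))"
    by (rule landau_omega.big_trans)
  with assms(1) show ?thesis
    unfolding soft_bigtheta_def by (intro CollectI exI[of _ 1]) simp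
qed

theorem theorem11:
  fixes X :: "(real^'d) set" and A :: "real^'d \<Rightarrow> real^'m^'d"
  assumes "finite X" and "X \<noteq> {}"
    and "\<And>x. x \<in> X \<Longrightarrow> onorm ((*v) (A x)) \<le> 1"
    and "diameter X \<le> 1"
  shows "if \<exists>!x. pareto_optimal X x then \<forall>n. minimax_regret X A n = 0
         else if locally_observable X A then
           minimax_regret X A \<in> soft_bigtheta (\<lambda>n. real n powr (1/2))
         else if globally_observable X A then
           minimax_regret X A \<in> soft_bigtheta (\<lambda>n. real n powr (2/3))
         else minimax_regret X A \<in> \<Omega>(\<lambda>n. real n)"
proof (cases "\<exists>!x. pareto_optimal X x")
  case True
  then obtain x where "X = {x}"
    using pareto_optimal_unique_iff[OF assms(1,2)] by auto
  with True show ?thesis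
    by (simp add: minimax_regret_singleton)
next
  case False
  \<comment> \<open>The case distinction becomes one on \<open>X\<close> itself: not being a
    singleton provides the two distinct actions that the square-root lower bound separates.\<close>
  then have "X \<noteq> {x}" for x
    by (metis pareto_optimal_unique_iff[OF assms(1,2)])
  then obtain x y where xy: "x \<in> X" "y \<in> X" "x \<noteq> y"
    using assms(2) by blast
  have "minimax_regret X A \<in> soft_bigtheta (\<lambda>n. real n powr (1/2))" if "locally_observable X A"
    by (rule soft_bigthetaI[OF minimax_regret_locally_observable[OF assms(1,2,4) that]
          minimax_regret_sqrt[OF assms(1,2,4,3) xy]])
  moreover have "minimax_regret X A \<in> soft_bigtheta (\<lambda>n. real n powr (2/3))"
    if "\<not> locally_observable X A" "globally_observable X A"
    by (rule soft_bigthetaI[OF minimax_regret_globally_observable[OF assms(1,2,4) that(2)]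
          minimax_regret_two_thirds[OF assms(1,2,4) that(1)]])
  moreover have "minimax_regret X A \<in> \<Omega>(\<lambda>n. real n)" if "\<not> globally_observable X A"
    by (rule minimax_regret_linear[OF assms(1,2,4) that])
  ultimately show ?thesis
    using False by simp
qed

end
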